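(* Let $f$ be an almost permutation of $\mathbb N$. Then $\mathfrak A_{\alpha_f}$ is countably saturated if and only if $f$ has only finitely many $\mathbb Z$-like orbits.
   Context: $\mathcal P(\mathbb N)/\mathrm{Fin}$ is the Boolean algebra of subsets of $\mathbb N$ modulo finite sets. An almost permutation of $\mathbb N$ is a bijection $f$ between cofinite subsets of $\mathbb N$; it induces the automorphism $\alpha_f([A]_{\mathrm{Fin}})=[f[A]]_{\mathrm{Fin}}$. For $n\in\mathrm{dom}(f)$ the orbit $O_f(n)=\{f^k(n):k\in\mathbb Z,\ f^k(n)\text{ defined}\}$ is $\mathbb Z$-like if it is infinite and $f^k(n)$ is defined for all $k\in\mathbb Z$ (the condition "finitely many $\mathbb Z$-like orbits" is what the paper writes as $\mathrm Z(f)\neq s_{\mathbb Z\times\mathbb Z}$). $\mathfrak A_\alpha=\langle\mathcal P(\mathbb N)/\mathrm{Fin},\alpha\rangle$ is a structure in the language of Boolean algebras expanded by a unary function symbol interpreted as $\alpha$. A structure is countably saturated if every consistent type over a countable set of parameters is realized in it (i.e., it is $\aleph_1$-saturated). *)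

theory Defs
  imports Main "HOL-Library.Countable_Set"
begin

section \<open>The Boolean algebra of sets of natural numbers modulo finite sets\<close>

definition eq_mod_fin :: "nat set \<Rightarrow> nat set \<Rightarrow> bool" where
  "eq_mod_fin A B \<longleftrightarrow> finite (sym_diff A B)"

lemma equivp_eq_mod_fin: "equivp eq_mod_fin"
proof (rule equivpI)
  show "reflp eq_mod_fin"
    by (simp add: reflp_def eq_mod_fin_def)
  show "symp eq_mod_fin"
    by (simp add: symp_def eq_mod_fin_def)
  show "transp eq_mod_fin"
  proof (rule transpI)
    fix A B C assume "eq_mod_fin A B" "eq_mod_fin B C"
    then have "finite (sym_diff A B \<union> sym_diff B C)"
      by (simp add: eq_mod_fin_def)
    moreover have "sym_diff A C \<subseteq> sym_diff A B \<union> sym_diff B C"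
      by blast
    ultimately show "eq_mod_fin A C"
      unfolding eq_mod_fin_def by (rule rev_finite_subset)
  qed
qed

quotient_type pnfin = "nat set" / eq_mod_fin
  by (rule equivp_eq_mod_fin)

instantiation pnfin :: boolean_algebra
begin

lift_definition bot_pnfin :: pnfin is "{}" .
lift_definition top_pnfin :: pnfin is "UNIV" .

lift_definition uminus_pnfin :: "pnfin \<Rightarrow> pnfin" is "\<lambda>A. - A"
  by (simp add: eq_mod_fin_def Diff_eq Int_commute)

lift_definition inf_pnfin :: "pnfin \<Rightarrow> pnfin \<Rightarrow> pnfin" is "(\<inter>)"
proof -
  fix A B C D assume "eq_mod_fin A B" "eq_mod_fin C D"
  then have "finite (sym_diff A B \<union> sym_diff C D)"
    by (simp add: eq_mod_fin_def)
  then show "eq_mod_fin (A \<inter> C) (B \<inter> D)"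
    unfolding eq_mod_fin_def by (rule rev_finite_subset) blast
qed

lift_definition sup_pnfin :: "pnfin \<Rightarrow> pnfin \<Rightarrow> pnfin" is "(\<union>)"
proof -
  fix A B C D assume "eq_mod_fin A B" "eq_mod_fin C D"
  then have "finite (sym_diff A B \<union> sym_diff C D)"
    by (simp add: eq_mod_fin_def)
  then show "eq_mod_fin (A \<union> C) (B \<union> D)"
    unfolding eq_mod_fin_def by (rule rev_finite_subset) blast
qed

lift_definition minus_pnfin :: "pnfin \<Rightarrow> pnfin \<Rightarrow> pnfin" is "(-)"
proof -
  fix A B C D assume "eq_mod_fin A B" "eq_mod_fin C D"
  then have "finite (sym_diff A B \<union> sym_diff C D)"
    by (simp add: eq_mod_fin_def)
  then show "eq_mod_fin (A - C) (B - D)"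
    unfolding eq_mod_fin_def by (rule rev_finite_subset) blast
qed

lift_definition less_eq_pnfin :: "pnfin \<Rightarrow> pnfin \<Rightarrow> bool" is "\<lambda>A B. finite (A - B)"
proof -
  have *: "finite (B - D)" if "eq_mod_fin A B" "eq_mod_fin C D" "finite (A - C)"
    for A B C D :: "nat set"
  proof (rule finite_subset)
    show "B - D \<subseteq> sym_diff A B \<union> sym_diff C D \<union> (A - C)" by blast
    show "finite (sym_diff A B \<union> sym_diff C D \<union> (A - C))"
      using that by (simp add: eq_mod_fin_def)
  qed
  fix A B C D :: "nat set" assume "eq_mod_fin A B" "eq_mod_fin C D"
  then show "finite (A - C) = finite (B - D)"
    using * equivp_symp[OF equivp_eq_mod_fin] by blast
qed

definition less_pnfin :: "pnfin \<Rightarrow> pnfin \<Rightarrow> bool" where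
  "less_pnfin a b \<longleftrightarrow> a \<le> b \<and> \<not> b \<le> a"

instance
proof
  fix x y z :: pnfin
  show "(x < y) = (x \<le> y \<and> \<not> y \<le> x)"
    by (rule less_pnfin_def)
  show "x \<le> x"
    by transfer simp
  show "x \<le> y \<Longrightarrow> y \<le> z \<Longrightarrow> x \<le> z"
  proof transfer
    fix A B C :: "nat set" assume "finite (A - B)" "finite (B - C)"
    then have "finite ((A - B) \<union> (B - C))" by simp
    then show "finite (A - C)" by (rule rev_finite_subset) blast
  qed
  show "x \<le> y \<Longrightarrow> y \<le> x \<Longrightarrow> x = y"
    by transfer (simp add: eq_mod_fin_def)
  show "inf x y \<le> x"
    by transfer (simp add: Diff_eq Int_ac)
  show "inf x y \<le> y"
    by transfer (simp add: Diff_eq Int_ac)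
  show "x \<le> y \<Longrightarrow> x \<le> z \<Longrightarrow> x \<le> inf y z"
    by transfer (simp add: Diff_Int)
  show "x \<le> sup x y"
    by transfer (simp add: Diff_eq Int_ac)
  show "y \<le> sup x y"
    by transfer (simp add: Diff_eq Int_ac)
  show "y \<le> x \<Longrightarrow> z \<le> x \<Longrightarrow> sup y z \<le> x"
    by transfer (simp add: Un_Diff)
  show "bot \<le> x"
    by transfer simp
  show "x \<le> top"
    by transfer simp
  show "sup x (inf y z) = inf (sup x y) (sup x z)"
    by transfer (simp add: eq_mod_fin_def Un_Int_distrib)
  show "inf x (- x) = bot"
    by transfer (simp add: eq_mod_fin_def)
  show "sup x (- x) = top"
    by transfer (simp add: eq_mod_fin_def)
  show "x - y = inf x (- y)"
    by transfer (simp add: eq_mod_fin_def Diff_eq)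
qed

end


section \<open>Almost permutations\<close>

definition almost_permutation :: "(nat \<rightharpoonup> nat) \<Rightarrow> bool" where
  "almost_permutation f \<longleftrightarrow>
     finite (- dom f) \<and> finite (- ran f) \<and> inj_on f (dom f)"

text \<open>The set \<^term>\<open>ran (f |` A)\<close> is the image of \<^term>\<open>A \<inter> dom f\<close> under the partial map
  \<^term>\<open>f\<close>. It respects equality modulo finite sets for every partial map.\<close>

lift_definition induced_map :: "(nat \<rightharpoonup> nat) \<Rightarrow> pnfin \<Rightarrow> pnfin"
  is "\<lambda>f A. ran (f |` A)"
proof -
  fix f :: "nat \<rightharpoonup> nat" and A B :: "nat set"
  assume "eq_mod_fin A B"
  then have "finite ((\<lambda>n. the (f n)) ` sym_diff A B)"
    by (simp add: eq_mod_fin_def)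
  moreover have "sym_diff (ran (f |` A)) (ran (f |` B)) \<subseteq> (\<lambda>n. the (f n)) ` sym_diff A B"
    by (force simp: ran_def restrict_map_def image_iff split: if_splits)
  ultimately show "eq_mod_fin (ran (f |` A)) (ran (f |` B))"
    unfolding eq_mod_fin_def by (rule rev_finite_subset)
qed

definition partial_inverse :: "(nat \<rightharpoonup> nat) \<Rightarrow> (nat \<rightharpoonup> nat)" where
  "partial_inverse f m = (if m \<in> ran f then Some (THE n. f n = Some m) else None)"

text \<open>The \<^term>\<open>k\<close>-th iterate of \<^term>\<open>f\<close> for an integer \<^term>\<open>k\<close>;
  the value \<^term>\<open>None\<close> means undefined.\<close>

definition iterate :: "(nat \<rightharpoonup> nat) \<Rightarrow> int \<Rightarrow> (nat \<rightharpoonup> nat)" where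
  "iterate f k =
     (if 0 \<le> k then ((\<lambda>g. f \<circ>\<^sub>m g) ^^ nat k) Some
      else ((\<lambda>g. partial_inverse f \<circ>\<^sub>m g) ^^ nat (- k)) Some)"

definition orbit :: "(nat \<rightharpoonup> nat) \<Rightarrow> nat \<Rightarrow> nat set" where
  "orbit f n = {m. \<exists>k. iterate f k n = Some m}"

definition Z_like_orbits :: "(nat \<rightharpoonup> nat) \<Rightarrow> nat set set" where
  "Z_like_orbits f =
     {orbit f n | n. n \<in> dom f \<and> infinite (orbit f n) \<and> (\<forall>k. iterate f k n \<noteq> None)}"


section \<open>Boolean algebras with a unary function as first-order structures\<close>

text \<open>Terms and formulas in the language of Boolean algebras expanded by a unary function symbol
  \<open>Fun\<close>. The type argument is the type of the parameters, which are used as constant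
  symbols. Variables are named by natural numbers.\<close>

datatype (params_tm: 'a) tm =
    Var nat
  | Param 'a
  | Zero
  | One
  | Compl "'a tm"
  | Meet "'a tm" "'a tm"
  | Join "'a tm" "'a tm"
  | Fun "'a tm"

datatype (params: 'a) fm =
    Equal "'a tm" "'a tm"
  | Neg "'a fm"
  | Conj "'a fm" "'a fm"
  | Exists nat "'a fm"

primrec vars_tm :: "'a tm \<Rightarrow> nat set" where
  "vars_tm (Var i) = {i}"
| "vars_tm (Param a) = {}"
| "vars_tm Zero = {}"
| "vars_tm One = {}"
| "vars_tm (Compl t) = vars_tm t"
| "vars_tm (Meet s t) = vars_tm s \<union> vars_tm t"
| "vars_tm (Join s t) = vars_tm s \<union> vars_tm t"
| "vars_tm (Fun t) = vars_tm t"

primrec free_vars :: "'a fm \<Rightarrow> nat set" where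
  "free_vars (Equal s t) = vars_tm s \<union> vars_tm t"
| "free_vars (Neg \<phi>) = free_vars \<phi>"
| "free_vars (Conj \<phi> \<psi>) = free_vars \<phi> \<union> free_vars \<psi>"
| "free_vars (Exists i \<phi>) = free_vars \<phi> - {i}"

primrec eval_tm :: "('a::boolean_algebra \<Rightarrow> 'a) \<Rightarrow> (nat \<Rightarrow> 'a) \<Rightarrow> 'a tm \<Rightarrow> 'a" where
  "eval_tm \<alpha> v (Var i) = v i"
| "eval_tm \<alpha> v (Param a) = a"
| "eval_tm \<alpha> v Zero = bot"
| "eval_tm \<alpha> v One = top"
| "eval_tm \<alpha> v (Compl t) = - eval_tm \<alpha> v t"
| "eval_tm \<alpha> v (Meet s t) = inf (eval_tm \<alpha> v s) (eval_tm \<alpha> v t)"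
| "eval_tm \<alpha> v (Join s t) = sup (eval_tm \<alpha> v s) (eval_tm \<alpha> v t)"
| "eval_tm \<alpha> v (Fun t) = \<alpha> (eval_tm \<alpha> v t)"

primrec sat :: "('a::boolean_algebra \<Rightarrow> 'a) \<Rightarrow> (nat \<Rightarrow> 'a) \<Rightarrow> 'a fm \<Rightarrow> bool" where
  "sat \<alpha> v (Equal s t) \<longleftrightarrow> eval_tm \<alpha> v s = eval_tm \<alpha> v t"
| "sat \<alpha> v (Neg \<phi>) \<longleftrightarrow> \<not> sat \<alpha> v \<phi>"
| "sat \<alpha> v (Conj \<phi> \<psi>) \<longleftrightarrow> sat \<alpha> v \<phi> \<and> sat \<alpha> v \<psi>"
| "sat \<alpha> v (Exists i \<phi>) \<longleftrightarrow> (\<exists>a. sat \<alpha> (v(i := a)) \<phi>)"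

definition type_over :: "nat \<Rightarrow> 'a set \<Rightarrow> 'a fm set \<Rightarrow> bool" where
  "type_over n A p \<longleftrightarrow> (\<forall>\<phi>\<in>p. free_vars \<phi> \<subseteq> {..<n} \<and> params \<phi> \<subseteq> A)"

definition realized :: "('a::boolean_algebra \<Rightarrow> 'a) \<Rightarrow> 'a fm set \<Rightarrow> bool" where
  "realized \<alpha> p \<longleftrightarrow> (\<exists>v. \<forall>\<phi>\<in>p. sat \<alpha> v \<phi>)"

text \<open>Consistency of a type is understood relative to the structure, that is, as finite
  satisfiability in it. By compactness this is the same as consistency with the elementary
  diagram of the structure.\<close>

definition consistent_type :: "('a::boolean_algebra \<Rightarrow> 'a) \<Rightarrow> 'a fm set \<Rightarrow> bool" where
  "consistent_type \<alpha> p \<longleftrightarrow> (\<forall>q. finite q \<and> q \<subseteq> p \<longrightarrow> realized \<alpha> q)"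

text \<open>The structure is the Boolean algebra given by the type \<^typ>\<open>'a\<close> with \<^term>\<open>\<alpha>\<close> as the
  interpretation of the additional function symbol. Types may be incomplete and
  may have any finite number \<^term>\<open>n\<close> of variables.\<close>

definition countably_saturated :: "('a::boolean_algebra \<Rightarrow> 'a) \<Rightarrow> bool" where
  "countably_saturated \<alpha> \<longleftrightarrow>
     (\<forall>n A p. countable A \<and> type_over n A p \<and> consistent_type \<alpha> p \<longrightarrow> realized \<alpha> p)"

end

theory Submission
  imports Defs "HOL-Library.Ramsey"
begin

text \<open>If there are only finitely many Z-like orbits, then there are only finitely many infinite
  orbits, and up to finitely many points \<open>f\<close> consists of finitely many one-sided rays and
  of finite orbits. Hence the natural numbers are a sequence of finite blocks such that only a
  bounded number of edges of \<open>f\<close> crosses from a block to the next one, so that sequences of sets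
  are infinite words and formulas are statements about tails of such words. By the composition
  method (Ehrenfeucht-Fraisse games on pieces between two cuts), a formula only depends on the
  types of the pieces along some sequence of cuts. Ramsey's theorem makes these types constant, for
  the parameters as well as for the approximate realizations of a type, which can then be
  spliced into a single realization.

  Conversely, an invariant element contains almost all or almost nothing of all but finitely many
  Z-like orbits, so it cannot separate the positive from the negative halves of infinitely many of
  them, although any finite number of them can be separated.\<close>

section \<open>Countability and Ramsey arguments\<close>

instance tm :: (countable) countable
  by countable_datatype

instance fm :: (countable) countable
  by countable_datatype

text \<open>Renaming the parameters through \<open>to_nat_on A\<close> turns such a formula into one
  with natural numbers as parameters, and the type of those is countable.\<close>

lemma countable_formulas:
  assumes "countable A"
  shows "countable {\<phi>. params \<phi> \<subseteq> A}"
proof -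
  have "{\<phi>. params \<phi> \<subseteq> A} \<subseteq> range (map_fm (from_nat_into A))"
  proof clarify
    fix \<phi> :: "'a fm" assume "params \<phi> \<subseteq> A"
    then have "map_fm (from_nat_into A) (map_fm (to_nat_on A) \<phi>) = \<phi>"
      using assms unfolding fm.map_comp by (intro fm.map_ident_strong) auto
    then show "\<phi> \<in> range (map_fm (from_nat_into A))"
      by (metis rangeI)
  qed
  then show ?thesis
    by (rule countable_subset) simp
qed

lemma finite_params_tm: "finite (params_tm t)"
  by (induction t) auto

lemma finite_params: "finite (params \<phi>)"
  by (induction \<phi>) (auto simp: finite_params_tm)

lemma Ramsey_pairs:
  fixes c :: "nat \<Rightarrow> nat \<Rightarrow> nat"
  assumes "infinite Z" and "finite {c s t | s t. True}"
  shows "\<exists>Y a. Y \<subseteq> Z \<and> infinite Y \<and> (\<forall>s\<in>Y. \<forall>t\<in>Y. s < t \<longrightarrow> c s t = a)"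
proof -
  \<comment> \<open>\<open>Ramsey2\<close> colours unordered pairs; \<open>Min\<close> and
    \<open>Max\<close> recover their order.\<close>
  define h where "h S = c (Min S) (Max S)" for S
  obtain N where N: "\<forall>n\<in>{c s t | s t. True}. n < N"
    using assms(2) unfolding finite_nat_set_iff_bounded ..
  have "h S < N" for S
    by (rule N[rule_format]) (auto simp: h_def)
  then have "\<forall>x\<in>Z. \<forall>y\<in>Z. x \<noteq> y \<longrightarrow> h {x, y} < N"
    by simp
  from Ramsey2[OF assms(1) this] obtain Y a where Y: "Y \<subseteq> Z" "infinite Y"
    and h: "\<forall>x\<in>Y. \<forall>y\<in>Y. x \<noteq> y \<longrightarrow> h {x, y} = a"
    by (elim exE conjE)
  have "c s t = a" if "s \<in> Y" "t \<in> Y" "s < t" for s t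
    using h[rule_format, of s t] that by (simp add: h_def)
  with Y show ?thesis by (intro exI[of _ Y] exI[of _ a]) simp
qed

text \<open>A decreasing chain of infinite sets \<open>H k\<close>, homogeneous for
  \<open>c k\<close>, is thinned diagonally: \<open>g s\<close> lies in \<open>H s\<close>, hence in
  \<open>H k\<close> once \<open>k \<le> s\<close>. So countably many colourings become constant
  along one sequence, each from its own index on.\<close>

lemma Ramsey_fusion:
  fixes c :: "nat \<Rightarrow> nat \<Rightarrow> nat \<Rightarrow> nat"
  assumes fin: "\<And>k. finite {c k s t | s t. True}"
  shows "\<exists>g a. strict_mono g \<and> (\<forall>k s t. k \<le> s \<and> s < t \<longrightarrow> c k (g s) (g t) = a k)"
proof -
  define P where "P k Y \<longleftrightarrow> infinite Y \<and> (\<exists>a. \<forall>s\<in>Y. \<forall>t\<in>Y. s < t \<longrightarrow> c k s t = a)" for k Y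
  have "\<exists>H. \<forall>k. P k (H k) \<and> H (Suc k) \<subseteq> H k"
  proof (rule dependent_nat_choice)
    show "\<exists>Y. P 0 Y"
      using Ramsey_pairs[OF infinite_UNIV_nat fin[of 0]] unfolding P_def by blast
    show "\<exists>Y'. P (Suc k) Y' \<and> Y' \<subseteq> Y" if "P k Y" for Y k
      using Ramsey_pairs[of Y "c (Suc k)", OF _ fin] that unfolding P_def by blast
  qed
  then obtain H where H: "\<And>k. P k (H k)" "\<And>k. H (Suc k) \<subseteq> H k" by blast
  have dec: "H t \<subseteq> H s" if "s \<le> t" for s t
    using lift_Suc_antimono_le[of H, OF H(2) that] .
  have "\<forall>k. \<exists>a. \<forall>s\<in>H k. \<forall>t\<in>H k. s < t \<longrightarrow> c k s t = a"
    using H(1) unfolding P_def by blast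
  from choice[OF this] obtain a
    where a: "\<And>k s t. s \<in> H k \<Longrightarrow> t \<in> H k \<Longrightarrow> s < t \<Longrightarrow> c k s t = a k"
    by blast
  have inf: "\<exists>x\<in>H k. x > y" for k y
    using H(1)[of k] unfolding P_def infinite_nat_iff_unbounded by blast
  have "\<exists>g. \<forall>k. g k \<in> H k \<and> g k < g (Suc k)"
    by (rule dependent_nat_choice) (use inf in blast)+
  then obtain g where g: "\<And>k. g k \<in> H k" "\<And>k. g k < g (Suc k)" by blast
  have mono: "strict_mono g"
    using g(2) by (simp add: strict_mono_Suc_iff)
  have "c k (g s) (g t) = a k" if "k \<le> s" "s < t" for k s t
  proof (rule a)
    show "g s \<in> H k" "g t \<in> H k"
      using g(1)[of s] g(1)[of t] dec[of k s] dec[of k t] that by auto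
    show "g s < g t"
      using mono that by (simp add: strict_mono_less)
  qed
  with mono show ?thesis by blast
qed

section \<open>The induced automorphism as a condition on edges\<close>

lemma almost_permutation_inj:
  "almost_permutation f \<Longrightarrow> f n = Some m \<Longrightarrow> f n' = Some m \<Longrightarrow> n = n'"
  unfolding almost_permutation_def by (metis domI inj_onD)

text \<open>An edge is counted by its target, which determines the source by injectivity. Points
  outside \<open>ran f\<close> are not seen by the right-hand side, but there are only finitely many
  of them.\<close>

lemma induced_map_eq_iff:
  assumes "almost_permutation f"
  shows "abs_pnfin Y = induced_map f (abs_pnfin X) \<longleftrightarrow>
     finite {m. \<exists>n. f n = Some m \<and> (n \<in> X) \<noteq> (m \<in> Y)}" (is "_ \<longleftrightarrow> finite ?E")
proof -
  note inj = almost_permutation_inj[OF assms]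
  have "?E \<subseteq> sym_diff Y (ran (f |` X))"
    by (auto simp: ran_def restrict_map_def split: if_splits dest: inj)
  moreover have "sym_diff Y (ran (f |` X)) \<subseteq> ?E \<union> - ran f"
    by (auto simp: ran_def restrict_map_def split: if_splits)
  moreover have "finite (- ran f)"
    using assms by (simp add: almost_permutation_def)
  ultimately have "finite (sym_diff Y (ran (f |` X))) \<longleftrightarrow> finite ?E"
    by (meson finite_UnI finite_subset)
  then show ?thesis
    by (simp add: induced_map.abs_eq pnfin.abs_eq_iff eq_mod_fin_def)
qed

section \<open>Types of pieces\<close>

definition label :: "nat set list \<Rightarrow> nat \<Rightarrow> bool list" where
  "label L n = map (\<lambda>X. n \<in> X) L"

lemma length_label [simp]: "length (label L n) = length L"
  by (simp add: label_def)

lemma label_nth [simp]: "i < length L \<Longrightarrow> label L n ! i \<longleftrightarrow> n \<in> L ! i"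
  by (simp add: label_def)

lemma label_append [simp]: "label (L @ M) n = label L n @ label M n"
  by (simp add: label_def)

lemma finite_labels: "finite {l :: bool list. length l = m}"
  using finite_lists_length_eq[of "UNIV :: bool set" m] by simp

text \<open>\<open>R\<close> indexes the one-sided rays; the point of ray \<open>q\<close> in block \<open>i\<close> is \<open>port q i\<close>, and \<open>f\<close> moves
  along the ray away from block \<open>0\<close> if \<open>fw q\<close> and towards it otherwise. All other edges of \<open>f\<close>
  stay inside a block.\<close>

locale tape =
  fixes f :: "nat \<rightharpoonup> nat" and blk :: "nat \<Rightarrow> nat"
    and R :: "'q::countable set" and port :: "'q \<Rightarrow> nat \<Rightarrow> nat" and fw :: "'q \<Rightarrow> bool"
  assumes perm: "almost_permutation f"
    and finite_R: "finite R"
    and finite_blk: "finite {n. blk n = i}"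
    and blk_port: "q \<in> R \<Longrightarrow> blk (port q i) = i"
    and edge_cases: "f n = Some m \<Longrightarrow> blk n = blk m \<or>
      (\<exists>q\<in>R. \<exists>i. if fw q then n = port q i \<and> m = port q (Suc i)
                 else n = port q (Suc i) \<and> m = port q i)"
    and port_edge: "q \<in> R \<Longrightarrow> if fw q then f (port q i) = Some (port q (Suc i))
                 else f (port q (Suc i)) = Some (port q i)"
begin

text \<open>The pairs tagged with \<^const>\<open>False\<close> are loops, so that conditions on points and conditions on
  edges of \<open>f\<close> are treated alike.\<close>

definition links :: "(bool \<times> nat \<times> nat) set" where
  "links = {(True, n, m) | n m. f n = Some m} \<union> {(False, n, n) | n. True}"

definition inner :: "nat \<Rightarrow> nat \<Rightarrow> (bool \<times> nat \<times> nat) set" where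
  "inner i j = {(b, n, m) \<in> links. blk n \<in> {i..<j} \<and> blk m \<in> {i..<j}}"

text \<open>The left summand collects the label patterns of links inside the piece. The right one
  records the labels of the ray points in the first block (\<open>False\<close>) and in the last
  block \<open>j - 1\<close> (\<open>True\<close>): this is what a neighbouring piece must know
  about the edges that cross the cut.\<close>

definition atoms :: "nat \<Rightarrow> nat \<Rightarrow> nat set list
    \<Rightarrow> ((bool \<times> bool list \<times> bool list) + (bool \<times> 'q \<times> bool list)) set" where
  "atoms i j L = Inl ` (\<lambda>(b, n, m). (b, label L n, label L m)) ` inner i j
     \<union> Inr ` ((\<lambda>q. (False, q, label L (port q i))) ` R
        \<union> (\<lambda>q. (True, q, label L (port q (j - 1)))) ` R)"

text \<open>The monadic second-order type of quantifier rank \<open>k\<close> of the piece that consists of the blocks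
  \<open>i, \<dots>, j - 1\<close>, labelled by the sets in \<open>L\<close>. It is encoded as a number, since there is no type of
  hereditarily finite sets.\<close>

primrec ty :: "nat \<Rightarrow> nat \<Rightarrow> nat \<Rightarrow> nat set list \<Rightarrow> nat" where
  "ty 0 i j L = set_encode (to_nat ` atoms i j L)"
| "ty (Suc k) i j L = set_encode (range (\<lambda>X. ty k i j (L @ [X])))"

lemma in_atoms:
  "Inl x \<in> atoms i j L \<longleftrightarrow> x \<in> (\<lambda>(b, n, m). (b, label L n, label L m)) ` inner i j"
  "Inr (False, q, l) \<in> atoms i j L \<longleftrightarrow> q \<in> R \<and> l = label L (port q i)"
  "Inr (True, q, l) \<in> atoms i j L \<longleftrightarrow> q \<in> R \<and> l = label L (port q (j - 1))"
  unfolding atoms_def by blast+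

lemma atoms_bound:
  "\<exists>U. finite U \<and> (\<forall>i j L. length L = m \<longrightarrow> atoms i j L \<subseteq> U)"
proof (intro exI conjI allI impI)
  let ?B = "{l :: bool list. length l = m}"
  show "finite (Inl ` ((UNIV :: bool set) \<times> ?B \<times> ?B) \<union> Inr ` ((UNIV :: bool set) \<times> R \<times> ?B))"
    using finite_labels finite_R
    by (intro finite_UnI finite_imageI finite_cartesian_product finite) simp_all
  fix i j and L :: "nat set list" assume "length L = m"
  then show "atoms i j L \<subseteq> Inl ` (UNIV \<times> ?B \<times> ?B) \<union> Inr ` (UNIV \<times> R \<times> ?B)"
    by (auto simp: atoms_def)
qed

text \<open>This finiteness makes types usable as Ramsey colours. A type of rank
  \<open>Suc k\<close> is a set of types of rank \<open>k\<close> for one more set, and there are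
  finitely many of those by induction.\<close>

lemma finite_ty: "finite {ty k i j L | i j L. length L = m}"
proof (induction k arbitrary: m)
  case 0
  obtain U where U: "finite U" "\<forall>i j L. length L = m \<longrightarrow> atoms i j L \<subseteq> U"
    using atoms_bound[of m] by (elim exE conjE)
  have "{ty 0 i j L | i j L. length L = m} \<subseteq> set_encode ` Pow (to_nat ` U)"
    using U(2) by (auto intro!: imageI image_mono)
  then show ?case
    using U(1) by (meson finite_Pow_iff finite_imageI finite_subset)
next
  case (Suc k)
  let ?V = "{ty k i j L | i j L. length L = Suc m}"
  have "{ty (Suc k) i j L | i j L. length L = m} \<subseteq> set_encode ` Pow ?V"
  proof
    fix u assume "u \<in> {ty (Suc k) i j L | i j L. length L = m}"
    then obtain i j and L :: "nat set list" where u: "u = ty (Suc k) i j L" "length L = m"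
      by blast
    then have "range (\<lambda>X. ty k i j (L @ [X])) \<in> Pow ?V" by force
    then show "u \<in> set_encode ` Pow ?V"
      unfolding u(1) ty.simps by (rule imageI)
  qed
  then show ?case
    using Suc by (meson finite_Pow_iff finite_imageI finite_subset)
qed

text \<open>\<open>set_encode\<close> is injective on finite sets only, so the bound on
  \<open>atoms\<close> is what makes the encoding faithful.\<close>

lemma ty_0_eq_iff:
  "ty 0 i j L = ty 0 i' j' L' \<longleftrightarrow> atoms i j L = atoms i' j' L'"
proof -
  have "finite (to_nat ` atoms i j L)" for i j L
    using atoms_bound[of "length L"] by (metis finite_imageI finite_subset)
  then show ?thesis
    by (simp add: set_encode_eq inj_image_eq_iff)
qed

lemma ty_Suc_eq_iff:
  "ty (Suc k) i j L = ty (Suc k) i' j' L' \<longleftrightarrow>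
     range (\<lambda>X. ty k i j (L @ [X])) = range (\<lambda>X. ty k i' j' (L' @ [X]))"
proof -
  have "finite (range (\<lambda>X. ty k i j (L @ [X])))" for i j L
    by (rule finite_subset[OF _ finite_ty[of k "Suc (length L)"]]) force
  then show ?thesis
    by (simp add: set_encode_eq)
qed

lemma ty_forth:
  assumes "ty (Suc k) i j L = ty (Suc k) i' j' L'"
  shows "\<exists>X'. ty k i j (L @ [X]) = ty k i' j' (L' @ [X'])"
  using assms unfolding ty_Suc_eq_iff by blast

lemma ty_SucI:
  assumes "\<And>X. \<exists>X'. ty k i j (L @ [X]) = ty k i' j' (L' @ [X'])"
    and "\<And>X'. \<exists>X. ty k i' j' (L' @ [X']) = ty k i j (L @ [X])"
  shows "ty (Suc k) i j L = ty (Suc k) i' j' L'"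
  unfolding ty_Suc_eq_iff using assms by fast

text \<open>A type determines the types of all lists obtained by selecting, permuting or repeating
  entries: at rank 0 the atoms are mapped by a fixed function, and a further move is just one more
  entry that is kept.\<close>

lemma ty_reindex:
  assumes "ty k i j L = ty k i' j' L'" "length L = length L'" "set idx \<subseteq> {..<length L}"
  shows "ty k i j (map ((!) L) idx) = ty k i' j' (map ((!) L') idx)"
  using assms
proof (induction k arbitrary: L L' idx)
  case 0
  define h :: "bool list \<Rightarrow> bool list" where "h l = map ((!) l) idx" for l
  define H where "H = map_sum (\<lambda>(b::bool, x, y). (b, h x, h y)) (\<lambda>(b::bool, q::'q, x). (b, q, h x))"
  have *: "atoms i j (map ((!) M) idx) = H ` atoms i j M" if "set idx \<subseteq> {..<length M}" for i j M
  proof -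
    have "label (map ((!) M) idx) = h \<circ> label M"
      using that by (auto simp: h_def label_def fun_eq_iff)
    then show ?thesis
      by (simp add: atoms_def H_def image_Un image_image case_prod_unfold)
  qed
  show ?case
    using 0 unfolding ty_0_eq_iff by (simp add: *)
next
  case (Suc k)
  have *: "\<exists>X'. ty k i j (map ((!) L) idx @ [X]) = ty k i' j' (map ((!) L') idx @ [X'])"
    if eq: "ty (Suc k) i j L = ty (Suc k) i' j' L'" "length L = length L'" "set idx \<subseteq> {..<length L}"
      and IH: "\<And>L L' idx. ty k i j L = ty k i' j' L' \<Longrightarrow> length L = length L' \<Longrightarrow> set idx \<subseteq> {..<length L} \<Longrightarrow>
        ty k i j (map ((!) L) idx) = ty k i' j' (map ((!) L') idx)"
    for L L' X i j i' j'
  proof -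
    obtain X' where X': "ty k i j (L @ [X]) = ty k i' j' (L' @ [X'])"
      using ty_forth[OF eq(1)] by blast
    \<comment> \<open>The new move sits at position \<open>length M\<close>; appending this index to
      \<open>idx\<close> keeps it last.\<close>
    have *: "map ((!) (M @ [Y])) (idx @ [length M]) = map ((!) M) idx @ [Y]"
      if "set idx \<subseteq> {..<length M}" for M :: "nat set list" and Y
      using that by (auto simp: nth_append)
    have "ty k i j (map ((!) (L @ [X])) (idx @ [length L]))
        = ty k i' j' (map ((!) (L' @ [X'])) (idx @ [length L']))"
      unfolding eq(2)[symmetric] by (rule IH[OF X']) (use eq(2,3) in auto)
    then show ?thesis
      unfolding *[OF eq(3)] *[OF eq(3)[unfolded eq(2)]] by (rule exI)
  qed
  show ?case
  proof (rule ty_SucI)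
    show "\<exists>X'. ty k i j (map ((!) L) idx @ [X]) = ty k i' j' (map ((!) L') idx @ [X'])" for X
      by (rule *[OF Suc.prems]) (rule Suc.IH)
    show "\<exists>X. ty k i' j' (map ((!) L') idx @ [X']) = ty k i j (map ((!) L) idx @ [X])" for X'
      by (rule *) (use Suc.prems in \<open>simp_all add: Suc.IH[symmetric]\<close>)
  qed
qed

text \<open>The rank drops by one when the empty set is played as a dummy move and then deleted by
  \<open>ty_reindex\<close>.\<close>

lemma ty_mono:
  assumes "ty k i j L = ty k i' j' L'" "length L = length L'" "k' \<le> k"
  shows "ty k' i j L = ty k' i' j' L'"
  using assms(3,1)
proof (induction k' rule: inc_induct)
  case (step k')
  obtain X' where "ty k' i j (L @ [{}]) = ty k' i' j' (L' @ [X'])"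
    using ty_forth[OF step.IH[OF step.prems]] by blast
  moreover have "map ((!) (M @ [Y])) [0..<length M] = M" for M :: "nat set list" and Y
    by (rule nth_equalityI) (auto simp: nth_append)
  ultimately show ?case
    using ty_reindex[of k' i j "L @ [{}]" i' j' "L' @ [X']" "[0..<length L]"] assms(2)
    by (metis Suc_n_not_le_n atLeast_upt le_cases length_append_singleton lessThan_subset_iff)
qed

text \<open>Since \<open>i < j\<close>, the blocks \<open>i\<close> and \<open>j - 1\<close> of the
  recorded ports belong to the piece, so labels outside never enter the type.\<close>

lemma ty_cong:
  assumes "i < j" "length L = length L'"
    and "\<And>n. blk n \<in> {i..<j} \<Longrightarrow> label L n = label L' n"
  shows "ty k i j L = ty k i j L'"
  using assms(2,3)
proof (induction k arbitrary: L L')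
  case 0
  have "label L (port q i) = label L' (port q i)"
    "label L (port q (j - 1)) = label L' (port q (j - 1))" if "q \<in> R" for q
    using that blk_port \<open>i < j\<close> by (auto intro!: 0(2))
  moreover have "(\<lambda>(b, n, m). (b, label L n, label L m)) ` inner i j
      = (\<lambda>(b, n, m). (b, label L' n, label L' m)) ` inner i j"
    by (rule image_cong) (auto simp: inner_def 0(2))
  ultimately show ?case
    unfolding ty_0_eq_iff atoms_def by (simp cong: image_cong_simp)
next
  case (Suc k)
  have "ty k i j (L @ [X]) = ty k i j (L' @ [X])" for X
    by (rule Suc.IH) (use Suc.prems in auto)
  then show ?case by simp
qed

text \<open>Composition of types. At rank 0 the atoms of the union are a function \<open>C\<close>
  of the atoms of the two pieces. At higher rank a move is answered in each piece separately and the
  answers are glued at the cut.\<close>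

lemma ty_compose:
  assumes "i < j" "j < l" "i' < j'" "j' < l'"
    and "ty k i j L = ty k i' j' L'" "ty k j l L = ty k j' l' L'" "length L = length L'"
  shows "ty k i l L = ty k i' l' L'"
  using assms(5-7)
proof (induction k arbitrary: L L')
  case 0
  \<comment> \<open>Besides the patterns inside the pieces, each ray gives one crossing edge,
    between the last port of the left piece and the first port of the right piece, directed
    according to \<open>fw\<close>. The outer ports survive.\<close>
  define C where "C P Q = {Inl x | x. Inl x \<in> P} \<union> {Inl x | x. Inl x \<in> Q}
     \<union> {Inl (True, x, y) | x y. \<exists>q\<in>R. if fw q then Inr (True, q, x) \<in> P \<and> Inr (False, q, y) \<in> Q
            else Inr (True, q, y) \<in> P \<and> Inr (False, q, x) \<in> Q}
     \<union> {Inr (False, x) | x. Inr (False, x) \<in> P} \<union> {Inr (True, x) | x. Inr (True, x) \<in> Q}"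
    for P Q :: "((bool \<times> bool list \<times> bool list) + (bool \<times> 'q \<times> bool list)) set"
  have "atoms i l L = C (atoms i j L) (atoms j l L)" if "i < j" "j < l" for i j l L
  proof -
    define X where "X = {(True, n, m) | n m. \<exists>q\<in>R. if fw q then n = port q (j - 1) \<and> m = port q j
         else m = port q (j - 1) \<and> n = port q j}"
    have "inner i l = inner i j \<union> inner j l \<union> X"
    proof (intro equalityI subsetI)
      fix u assume u: "u \<in> inner i l"
      show "u \<in> inner i j \<union> inner j l \<union> X"
      proof (cases "blk (fst (snd u)) < j \<longleftrightarrow> blk (snd (snd u)) < j")
        case True
        with u show ?thesis by (auto simp: inner_def not_less)
      next
        case False
        \<comment> \<open>A link with its ends on both sides of the cut is no loop, hence an edge of
          \<open>f\<close> between blocks.\<close>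
        then obtain n m where nm: "u = (True, n, m)" "f n = Some m"
          using u by (auto simp: inner_def links_def)
        with False have "blk n \<noteq> blk m" by auto
        then obtain q t where q: "q \<in> R" "if fw q then n = port q t \<and> m = port q (Suc t)
             else n = port q (Suc t) \<and> m = port q t"
          using edge_cases[OF nm(2)] by blast
        then have "t = j - 1 \<and> Suc t = j"
          using False nm by (auto simp: blk_port split: if_splits)
        with q have "u \<in> X"
          unfolding X_def nm by (auto split: if_splits)
        then show ?thesis by blast
      qed
    next
      have "X \<subseteq> inner i l"
      proof
        fix u assume "u \<in> X"
        then obtain q n m where q: "u = (True, n, m)" "q \<in> R" "if fw q then n = port q (j - 1) \<and> m = port q j
         else m = port q (j - 1) \<and> n = port q j"
          unfolding X_def by blast
        with port_edge[OF q(2), of "j - 1"] that show "u \<in> inner i l"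
          by (auto simp: inner_def links_def blk_port split: if_splits)
      qed
      then show "u \<in> inner i l" if "u \<in> inner i j \<union> inner j l \<union> X" for u
        using that \<open>i < j\<close> \<open>j < l\<close> by (auto simp: inner_def)
    qed
    moreover have "(\<lambda>(b, n, m). (b, label L n, label L m)) ` X = {(True, x, y) | x y. \<exists>q\<in>R.
        if fw q then x = label L (port q (j - 1)) \<and> y = label L (port q j)
        else y = label L (port q (j - 1)) \<and> x = label L (port q j)}" (is "?l = ?r")
    proof (intro equalityI subsetI)
      show "u \<in> ?r" if "u \<in> ?l" for u
        using that unfolding X_def by (fastforce split: if_splits)
      show "u \<in> ?l" if "u \<in> ?r" for u
      proof -
        obtain q x y where q: "u = (True, x, y)" "q \<in> R" "if fw q then x = label L (port q (j - 1)) \<and> y = label L (port q j)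
           else y = label L (port q (j - 1)) \<and> x = label L (port q j)"
          using \<open>u \<in> ?r\<close> by blast
        then have "(True, if fw q then (port q (j - 1), port q j) else (port q j, port q (j - 1))) \<in> X"
          unfolding X_def by (auto)
        from imageI[OF this, of "\<lambda>(b, n, m). (b, label L n, label L m)"] q show ?thesis
          by (auto split: if_splits)
      qed
    qed
    ultimately have Inl: "(\<lambda>(b, n, m). (b, label L n, label L m)) ` inner i l =
        (\<lambda>(b, n, m). (b, label L n, label L m)) ` inner i j
        \<union> (\<lambda>(b, n, m). (b, label L n, label L m)) ` inner j l \<union> ?r"
      by (simp only: image_Un)
    have "v \<in> atoms i l L \<longleftrightarrow> v \<in> C (atoms i j L) (atoms j l L)" for v
    proof (cases v)
      case v: (Inl x)
      obtain b y z where x: "x = (b, y, z)" by (rule prod_cases3)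
      show ?thesis
        unfolding v x in_atoms Inl C_def by (simp add: in_atoms cong: if_cong)
    next
      case (Inr y)
      then obtain b q x where v: "v = Inr (b, q, x)" by (metis prod.exhaust)
      show ?thesis
        by (cases b) (auto simp: v in_atoms C_def)
    qed
    then show ?thesis by blast
  qed
  then show ?case
    using 0 assms(1-4) unfolding ty_0_eq_iff by simp
next
  case (Suc k)
  have glue: "\<exists>X'. ty k i l (L @ [X]) = ty k i' l' (L' @ [X'])"
    if o: "i < j" "j < l" "i' < j'" "j' < l'"
      and eq: "ty (Suc k) i j L = ty (Suc k) i' j' L'" "ty (Suc k) j l L = ty (Suc k) j' l' L'"
       "length L = length L'"
      and IH: "\<And>L L'. ty k i j L = ty k i' j' L' \<Longrightarrow> ty k j l L = ty k j' l' L' \<Longrightarrow> length L = length L' \<Longrightarrow>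
          ty k i l L = ty k i' l' L'"
    for L L' X i j l i' j' l'
  proof -
    obtain Y Z where YZ: "ty k i j (L @ [X]) = ty k i' j' (L' @ [Y])" "ty k j l (L @ [X]) = ty k j' l' (L' @ [Z])"
      using ty_forth[OF eq(1)] ty_forth[OF eq(2)] by blast
    \<comment> \<open>The two answers are glued along the block boundary \<open>j'\<close>.\<close>
    define X' where "X' = {n \<in> Y. blk n < j'} \<union> {n \<in> Z. j' \<le> blk n}"
    have "ty k i' j' (L' @ [X']) = ty k i' j' (L' @ [Y])" "ty k j' l' (L' @ [X']) = ty k j' l' (L' @ [Z])"
      using o by (auto intro!: ty_cong simp: label_def X'_def)
    with YZ IH[of "L @ [X]" "L' @ [X']"] eq(3) show ?thesis by auto
  qed
  show ?case
  proof (rule ty_SucI)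
    show "\<exists>X'. ty k i l (L @ [X]) = ty k i' l' (L' @ [X'])" for X
      by (rule glue[OF assms(1-4) Suc.prems]) (rule Suc.IH)
    show "\<exists>X. ty k i' l' (L' @ [X']) = ty k i l (L @ [X])" for X'
      by (rule glue[OF assms(3,4,1,2) Suc.prems[symmetric]]) (metis Suc.IH)
  qed
qed

lemmas f_inj = almost_permutation_inj[OF perm]

section \<open>Equivalence of infinite words\<close>

lemma finite_blk_less: "finite {n. blk n < K}"
proof -
  have "{n. blk n < K} = (\<Union>i<K. {n. blk n = i})" by auto
  then show ?thesis using finite_blk by simp
qed

text \<open>Every atomic formula will be expressed as the finiteness of such a set, for a suitable
  forbidden pattern \<open>Q\<close>.\<close>

definition bad :: "(bool \<Rightarrow> bool list \<Rightarrow> bool list \<Rightarrow> bool) \<Rightarrow> nat set list \<Rightarrow> (bool \<times> nat \<times> nat) set" where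
  "bad Q L = {(b, n, m) \<in> links. Q b (label L n) (label L m)}"

text \<open>Finiteness means that the pattern is absent beyond some cut, and this can be read off
  from the atoms of the pieces alone.\<close>

lemma finite_bad_iff:
  assumes d: "strict_mono (d :: nat \<Rightarrow> nat)"
  shows "finite (bad Q L) \<longleftrightarrow> (\<exists>S. \<forall>t>S. \<forall>b x y. Inl (b, x, y) \<in> atoms (d S) (d t) L \<longrightarrow> \<not> Q b x y)"
proof
  assume "finite (bad Q L)"
  then have "finite ((\<lambda>(b, n, m). blk n) ` bad Q L)" by simp
  then obtain S where S: "\<forall>i\<in>(\<lambda>(b, n, m). blk n) ` bad Q L. i < S"
    unfolding finite_nat_set_iff_bounded ..
  have "\<not> Q b x y" if inl: "Inl (b, x, y) \<in> atoms (d S) (d t) L" for t b x y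
  proof
    assume "Q b x y"
    obtain n m where *: "(b, n, m) \<in> inner (d S) (d t)" "x = label L n" "y = label L m"
      using inl unfolding in_atoms by auto
    with \<open>Q b x y\<close> have "(b, n, m) \<in> bad Q L"
      by (simp add: bad_def inner_def)
    with S have "blk n < S" by fastforce
    moreover have "d S \<le> blk n" using * by (simp add: inner_def)
    ultimately show False
      using strict_mono_imp_increasing[OF d, of S] by simp
  qed
  then show "\<exists>S. \<forall>t>S. \<forall>b x y. Inl (b, x, y) \<in> atoms (d S) (d t) L \<longrightarrow> \<not> Q b x y"
    by blast
next
  assume "\<exists>S. \<forall>t>S. \<forall>b x y. Inl (b, x, y) \<in> atoms (d S) (d t) L \<longrightarrow> \<not> Q b x y"
  then obtain S where S: "\<And>t b x y. S < t \<Longrightarrow> Inl (b, x, y) \<in> atoms (d S) (d t) L \<Longrightarrow> \<not> Q b x y"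
    by blast
  define A where "A = {n. blk n < d S}"
  have A: "finite A" unfolding A_def by (rule finite_blk_less)
  \<comment> \<open>By injectivity of \<open>f\<close>, a link is determined by its tag and either
    end, so only finitely many links touch the finite set \<open>A\<close>.\<close>
  have "finite {(b, n, m) \<in> links. n \<in> A}"
  proof (rule finite_imageD)
    show "finite ((\<lambda>(b, n, m). (b, n)) ` {(b, n, m) \<in> links. n \<in> A})"
      by (rule finite_subset[of _ "UNIV \<times> A"]) (use A in auto)
  qed (auto simp: inj_on_def links_def)
  moreover have "finite {(b, n, m) \<in> links. m \<in> A}"
  proof (rule finite_imageD)
    show "finite ((\<lambda>(b, n, m). (b, m)) ` {(b, n, m) \<in> links. m \<in> A})"
      by (rule finite_subset[of _ "UNIV \<times> A"]) (use A in auto)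
  qed (auto simp: inj_on_def links_def dest: f_inj)
  moreover have "bad Q L \<subseteq> {(b, n, m) \<in> links. n \<in> A} \<union> {(b, n, m) \<in> links. m \<in> A}"
  proof
    fix u assume u: "u \<in> bad Q L"
    obtain b n m where bnm: "u = (b, n, m)" by (rule prod_cases3)
    with u have *: "(b, n, m) \<in> links" "Q b (label L n) (label L m)"
      by (auto simp: bad_def)
    have "blk n < d S \<or> blk m < d S"
    proof (rule ccontr)
      assume "\<not> ?thesis"
    \<comment> \<open>This cut is far enough out for \<open>d t\<close> to exceed the blocks of both
      ends.\<close>
    define t where "t = Suc (blk n + blk m + S)"
    have "t \<le> d t" by (rule strict_mono_imp_increasing[OF d])
    with * \<open>\<not> (blk n < d S \<or> blk m < d S)\<close> have "(b, n, m) \<in> inner (d S) (d t)"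
      by (auto simp: inner_def t_def)
    then have "Inl (b, label L n, label L m) \<in> atoms (d S) (d t) L"
      unfolding in_atoms by force
    with S[of t] * show False by (simp add: t_def)
    qed
    then show "u \<in> {(b, n, m) \<in> links. n \<in> A} \<union> {(b, n, m) \<in> links. m \<in> A}"
      using * bnm by (auto simp: A_def)
  qed
  ultimately show "finite (bad Q L)"
    by (meson finite_UnI finite_subset)
qed

text \<open>Equivalence of infinite words: both can be cut, possibly at different places, into
  pieces of equal types. What precedes the first cut is ignored, being finite.\<close>

definition sim :: "nat \<Rightarrow> nat set list \<Rightarrow> nat set list \<Rightarrow> bool" where
  "sim k L L' \<longleftrightarrow> length L = length L' \<and> (\<exists>d d'. strict_mono d \<and> strict_mono d' \<and>
     (\<forall>s. ty k (d s) (d (Suc s)) L = ty k (d' s) (d' (Suc s)) L'))"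

lemma sim_length: "sim k L L' \<Longrightarrow> length L' = length L"
  by (simp add: sim_def)

lemma sim_sym: "sim k L L' \<Longrightarrow> sim k L' L"
  unfolding sim_def by metis

lemma sim_mono: "sim k L L' \<Longrightarrow> k' \<le> k \<Longrightarrow> sim k' L L'"
  unfolding sim_def using ty_mono by metis

text \<open>By \<open>ty_compose\<close> the types agree between any two corresponding cuts, not
  just consecutive ones, so the criterion \<open>finite_bad_iff\<close> has the same outcome on both
  sides.\<close>

lemma sim_finite_bad:
  assumes "sim k L L'"
  shows "finite (bad Q L) \<longleftrightarrow> finite (bad Q L')"
proof -
  obtain d d' where d: "strict_mono d" "strict_mono d'" and len: "length L = length L'"
    and eq: "\<And>s. ty 0 (d s) (d (Suc s)) L = ty 0 (d' s) (d' (Suc s)) L'"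
    using sim_mono[OF assms, of 0] unfolding sim_def by auto
  have "ty 0 (d s) (d t) L = ty 0 (d' s) (d' t) L'" if "Suc s \<le> t" for s t
    using that
  proof (induction t rule: dec_induct)
    case base
    show ?case by (rule eq)
  next
    case (step t)
    show ?case
      by (rule ty_compose[OF _ _ _ _ step.IH eq[of t] len])
        (use step d in \<open>auto simp: strict_mono_less\<close>)
  qed
  then have "atoms (d s) (d t) L = atoms (d' s) (d' t) L'" if "s < t" for s t
    using that by (simp only: ty_0_eq_iff Suc_le_eq)
  then show ?thesis
    unfolding finite_bad_iff[OF d(1), of Q L] finite_bad_iff[OF d(2), of Q L'] by (simp cong: imp_cong)
qed

text \<open>A move is answered piece by piece, with the cuts unchanged and the answers put
  together.\<close>

lemma sim_forth:
  assumes "sim (Suc k) L L'"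
  shows "\<exists>X'. sim k (L @ [X]) (L' @ [X'])"
proof -
  obtain d d' where d: "strict_mono d" "strict_mono d'" and len: "length L = length L'"
    and eq: "\<And>s. ty (Suc k) (d s) (d (Suc s)) L = ty (Suc k) (d' s) (d' (Suc s)) L'"
    using assms unfolding sim_def by blast
  have "\<forall>s. \<exists>Y. ty k (d s) (d (Suc s)) (L @ [X]) = ty k (d' s) (d' (Suc s)) (L' @ [Y])"
    using ty_forth[OF eq] by blast
  from choice[OF this] obtain Y
    where Y: "\<And>s. ty k (d s) (d (Suc s)) (L @ [X]) = ty k (d' s) (d' (Suc s)) (L' @ [Y s])"
    by blast
  \<comment> \<open>Points before the first cut \<open>d' 0\<close> are left out; every other point
    lies in exactly one piece.\<close>
  define X' where "X' = {n. \<exists>s. d' s \<le> blk n \<and> blk n < d' (Suc s) \<and> n \<in> Y s}"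
  have "n \<in> X' \<longleftrightarrow> n \<in> Y s" if "d' s \<le> blk n" "blk n < d' (Suc s)" for n s
  proof -
    have "s' = s" if "d' s' \<le> blk n" "blk n < d' (Suc s')" for s'
    proof -
      have "d' s < d' (Suc s')" "d' s' < d' (Suc s)"
        using that \<open>d' s \<le> blk n\<close> \<open>blk n < d' (Suc s)\<close> by linarith+
      then show ?thesis using d(2) by (simp add: strict_mono_less)
    qed
    with that show ?thesis unfolding X'_def by blast
  qed
  then have "ty k (d' s) (d' (Suc s)) (L' @ [X']) = ty k (d' s) (d' (Suc s)) (L' @ [Y s])" for s
    using d(2) by (intro ty_cong) (auto simp: label_def strict_mono_less)
  then have "\<forall>s. ty k (d s) (d (Suc s)) (L @ [X]) = ty k (d' s) (d' (Suc s)) (L' @ [X'])"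
    using Y by simp
  with d len have "sim k (L @ [X]) (L' @ [X'])"
    unfolding sim_def by auto
  then show ?thesis ..
qed

text \<open>A Boolean identity is a condition on loops; the arbitrary \<open>B\<close> covers all
  Boolean operations at once.\<close>

lemma sim_bool:
  assumes "sim k L L'" "i < length L" "j < length L" "l < length L"
  shows "finite {n. (n \<in> L ! l) \<noteq> B (n \<in> L ! i) (n \<in> L ! j)} \<longleftrightarrow>
         finite {n. (n \<in> L' ! l) \<noteq> B (n \<in> L' ! i) (n \<in> L' ! j)}"
proof -
  let ?Q = "\<lambda>b x y. \<not> b \<and> x ! l \<noteq> B (x ! i) (x ! j)"
  have *: "finite (bad ?Q M) \<longleftrightarrow> finite {n. (n \<in> M ! l) \<noteq> B (n \<in> M ! i) (n \<in> M ! j)}"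
    if "length M = length L" for M
  proof -
    have "bad ?Q M = (\<lambda>n. (False, n, n)) ` {n. (n \<in> M ! l) \<noteq> B (n \<in> M ! i) (n \<in> M ! j)}"
      using assms(2-4) that by (auto simp: bad_def links_def image_iff)
    then show ?thesis
      by (simp add: finite_image_iff inj_on_def)
  qed
  show ?thesis
    using sim_finite_bad[OF assms(1), of ?Q] *[of L] *[OF sim_length[OF assms(1)]] by simp
qed

lemma sim_edge:
  assumes "sim k L L'" "i < length L" "l < length L"
  shows "finite {m. \<exists>n. f n = Some m \<and> (n \<in> L ! i) \<noteq> (m \<in> L ! l)} \<longleftrightarrow>
         finite {m. \<exists>n. f n = Some m \<and> (n \<in> L' ! i) \<noteq> (m \<in> L' ! l)}"
proof -
  let ?Q = "\<lambda>b x y. b \<and> x ! i \<noteq> y ! l"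
  have *: "finite (bad ?Q M) \<longleftrightarrow> finite {m. \<exists>n. f n = Some m \<and> (n \<in> M ! i) \<noteq> (m \<in> M ! l)}"
    if "length M = length L" for M
  proof -
    have "inj_on (\<lambda>(b, n, m). m) (bad ?Q M)"
      by (auto simp: inj_on_def bad_def links_def dest: f_inj)
    moreover have "(\<lambda>(b, n, m). m) ` bad ?Q M = {m. \<exists>n. f n = Some m \<and> (n \<in> M ! i) \<noteq> (m \<in> M ! l)}"
      using assms(2,3) that by (force simp: bad_def links_def image_iff)
    ultimately show ?thesis
      by (simp only: finite_image_iff[symmetric])
  qed
  show ?thesis
    using sim_finite_bad[OF assms(1), of ?Q] *[of L] *[OF sim_length[OF assms(1)]] by simp
qed

section \<open>Transfer of terms and formulas along equivalent words\<close>

definition rel :: "nat set list \<Rightarrow> nat set list \<Rightarrow> pnfin \<Rightarrow> pnfin \<Rightarrow> bool" where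
  "rel L L' a a' \<longleftrightarrow> (\<exists>i<length L. abs_pnfin (L ! i) = a \<and> abs_pnfin (L' ! i) = a')"

lemma rel_append:
  "rel L L' a a' \<Longrightarrow> length L' = length L \<Longrightarrow> rel (L @ M) (L' @ M') a a'"
  unfolding rel_def by (metis length_append nth_append trans_less_add1)

lemma rel_last:
  "length L' = length L \<Longrightarrow> rel (L @ [X]) (L' @ [X']) (abs_pnfin X) (abs_pnfin X')"
  unfolding rel_def by (metis length_append_singleton lessI nth_append_length)

lemma rel_sym: "rel L L' a a' \<Longrightarrow> length L' = length L \<Longrightarrow> rel L' L a' a"
  unfolding rel_def by metis

lemma abs_bool_iff:
  "abs_pnfin X = abs_pnfin Y \<longleftrightarrow> finite {n. (n \<in> X) \<noteq> (n \<in> Y)}"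
  "abs_pnfin X = bot \<longleftrightarrow> finite {n. (n \<in> X) \<noteq> False}"
  "abs_pnfin X = top \<longleftrightarrow> finite {n. (n \<in> X) \<noteq> True}"
  "abs_pnfin X = - abs_pnfin Y \<longleftrightarrow> finite {n. (n \<in> X) \<noteq> (n \<notin> Y)}"
  "abs_pnfin X = inf (abs_pnfin Y) (abs_pnfin Z) \<longleftrightarrow> finite {n. (n \<in> X) \<noteq> (n \<in> Y \<and> n \<in> Z)}"
  "abs_pnfin X = sup (abs_pnfin Y) (abs_pnfin Z) \<longleftrightarrow> finite {n. (n \<in> X) \<noteq> (n \<in> Y \<or> n \<in> Z)}"
proof -
  have *: "abs_pnfin X = abs_pnfin W \<longleftrightarrow> finite {n. (n \<in> X) \<noteq> (n \<in> W)}" for W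
  proof -
    have "sym_diff X W = {n. (n \<in> X) \<noteq> (n \<in> W)}" by blast
    then show ?thesis by (simp only: pnfin.abs_eq_iff eq_mod_fin_def)
  qed
  show "abs_pnfin X = abs_pnfin Y \<longleftrightarrow> finite {n. (n \<in> X) \<noteq> (n \<in> Y)}"
    "abs_pnfin X = bot \<longleftrightarrow> finite {n. (n \<in> X) \<noteq> False}"
    "abs_pnfin X = top \<longleftrightarrow> finite {n. (n \<in> X) \<noteq> True}"
    "abs_pnfin X = - abs_pnfin Y \<longleftrightarrow> finite {n. (n \<in> X) \<noteq> (n \<notin> Y)}"
    "abs_pnfin X = inf (abs_pnfin Y) (abs_pnfin Z) \<longleftrightarrow> finite {n. (n \<in> X) \<noteq> (n \<in> Y \<and> n \<in> Z)}"
    "abs_pnfin X = sup (abs_pnfin Y) (abs_pnfin Z) \<longleftrightarrow> finite {n. (n \<in> X) \<noteq> (n \<in> Y \<or> n \<in> Z)}"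
    by (simp_all only: bot_pnfin.abs_eq top_pnfin.abs_eq uminus_pnfin.abs_eq inf_pnfin.abs_eq
      sup_pnfin.abs_eq * Compl_iff Int_iff Un_iff empty_iff UNIV_I)
qed

lemma pnfin_rep: "\<exists>X. abs_pnfin X = a"
  by (metis Quotient_abs_rep Quotient_pnfin)

text \<open>The pairs matched by \<open>rel\<close> form a partial isomorphism, because every atomic
  relation among them is the finiteness of some \<open>bad\<close> set.\<close>

lemma rel_ops:
  assumes "sim k L L'" "rel L L' c c'" "rel L L' a a'" "rel L L' b b'"
  shows "c = bot \<longleftrightarrow> c' = bot" "c = top \<longleftrightarrow> c' = top" "c = a \<longleftrightarrow> c' = a'" "c = - a \<longleftrightarrow> c' = - a'"
    "c = inf a b \<longleftrightarrow> c' = inf a' b'" "c = sup a b \<longleftrightarrow> c' = sup a' b'"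
    "c = induced_map f a \<longleftrightarrow> c' = induced_map f a'"
proof -
  obtain l i j where *: "l < length L" "i < length L" "j < length L"
    "c = abs_pnfin (L ! l)" "c' = abs_pnfin (L' ! l)"
    "a = abs_pnfin (L ! i)" "a' = abs_pnfin (L' ! i)"
    "b = abs_pnfin (L ! j)" "b' = abs_pnfin (L' ! j)"
    using assms(2-4) unfolding rel_def by metis
  note sb = sim_bool[OF assms(1) *(2,3,1)]
  show "c = bot \<longleftrightarrow> c' = bot" "c = top \<longleftrightarrow> c' = top" "c = a \<longleftrightarrow> c' = a'" "c = - a \<longleftrightarrow> c' = - a'"
    "c = inf a b \<longleftrightarrow> c' = inf a' b'" "c = sup a b \<longleftrightarrow> c' = sup a' b'"
    unfolding *(4-9) abs_bool_iff
    using sb[of "\<lambda>_ _. False"] sb[of "\<lambda>_ _. True"] sb[of "\<lambda>x _. x"] sb[of "\<lambda>x _. \<not> x"]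
      sb[of "(\<and>)"] sb[of "(\<or>)"] by fast+
  show "c = induced_map f a \<longleftrightarrow> c' = induced_map f a'"
    unfolding *(4-9) induced_map_eq_iff[OF perm] by (rule sim_edge[OF assms(1) *(2,1)])
qed

lemma rel_forth:
  assumes "sim (Suc k) L L'"
  shows "\<exists>X X' c'. sim k (L @ [X]) (L' @ [X']) \<and> rel (L @ [X]) (L' @ [X']) c c'"
  using pnfin_rep[of c] sim_forth[OF assms] rel_last[OF sim_length[OF assms]] by metis

text \<open>The number of moves spent on evaluating a term. Variables and parameters are in the list
  already, whereas the value of a constant or of a compound term has to be played.\<close>

primrec rank_tm :: "'a tm \<Rightarrow> nat" where
  "rank_tm (Var i) = 0"
| "rank_tm (Param a) = 0"
| "rank_tm Zero = 1"
| "rank_tm One = 1"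
| "rank_tm (Compl t) = Suc (rank_tm t)"
| "rank_tm (Meet s t) = Suc (rank_tm s + rank_tm t)"
| "rank_tm (Join s t) = Suc (rank_tm s + rank_tm t)"
| "rank_tm (Fun t) = Suc (rank_tm t)"

primrec rank :: "'a fm \<Rightarrow> nat" where
  "rank (Equal s t) = rank_tm s + rank_tm t"
| "rank (Neg \<phi>) = rank \<phi>"
| "rank (Conj \<phi> \<psi>) = max (rank \<phi>) (rank \<psi>)"
| "rank (Exists i \<phi>) = Suc (rank \<phi>)"

text \<open>A position reached from \<open>L\<close>, \<open>L'\<close> by further moves on both
  sides, with \<open>k\<close> rounds left.\<close>

definition ext :: "nat \<Rightarrow> nat set list \<Rightarrow> nat set list \<Rightarrow> nat set list \<Rightarrow> nat set list \<Rightarrow> bool" where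
  "ext k L L' K K' \<longleftrightarrow> sim k K K' \<and> (\<exists>M M'. K = L @ M \<and> K' = L' @ M' \<and> length M' = length M)"

lemma ext_refl: "sim k L L' \<Longrightarrow> ext k L L' L L'"
  by (simp add: ext_def)

lemma ext_trans: "ext k L L' K K' \<Longrightarrow> ext k' K K' N N' \<Longrightarrow> ext k' L L' N N'"
  unfolding ext_def by (metis append.assoc length_append)

lemma ext_sim: "ext k L L' K K' \<Longrightarrow> sim k K K'"
  by (simp add: ext_def)

lemma ext_rel: "ext k L L' K K' \<Longrightarrow> rel L L' a a' \<Longrightarrow> rel K K' a a'"
  unfolding ext_def using rel_append sim_length by (metis add_right_cancel length_append)

lemma ext_forth:
  assumes "sim (Suc k) L L'"
  shows "\<exists>K K' c'. ext k L L' K K' \<and> rel K K' c c'"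
  using rel_forth[OF assms, of c] unfolding ext_def by fastforce

lemma eval_sim:
  fixes v v' :: "nat \<Rightarrow> pnfin"
  assumes "sim (k + rank_tm t) L L'"
    and "\<And>i. i \<in> vars_tm t \<Longrightarrow> rel L L' (v i) (v' i)"
    and "\<And>a. a \<in> params_tm t \<Longrightarrow> rel L L' a a"
  shows "\<exists>K K'. ext k L L' K K' \<and>
     rel K K' (eval_tm (induced_map f) v t) (eval_tm (induced_map f) v' t)"
  using assms
proof (induction t arbitrary: k L L')
  case (Var i)
  then show ?case using ext_refl[of k L L'] by auto
next
  case (Param a)
  then show ?case using ext_refl[of k L L'] by auto
next
  case Zero
  then obtain K K' c' where "ext k L L' K K'" "rel K K' bot c'"
    using ext_forth[of k L L' bot] by auto
  then show ?case
    using rel_ops(1)[OF ext_sim] by fastforce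
next
  case One
  then obtain K K' c' where "ext k L L' K K'" "rel K K' top c'"
    using ext_forth[of k L L' top] by auto
  then show ?case
    using rel_ops(2)[OF ext_sim] by fastforce
next
  case (Compl t)
  let ?e = "\<lambda>v. eval_tm (induced_map f) v t"
  obtain K K' where K: "ext (Suc k) L L' K K'" "rel K K' (?e v) (?e v')"
    using Compl.IH[of "Suc k" L L'] Compl.prems by auto
  \<comment> \<open>The value under \<open>v\<close> is played as a move; by \<open>rel_ops\<close>
    the answer can only be the value under \<open>v'\<close>.\<close>
  obtain N N' c' where N: "ext k K K' N N'" "rel N N' (- ?e v) c'"
    using ext_forth[OF ext_sim[OF K(1)]] by blast
  have "c' = - ?e v'"
    using rel_ops(4)[OF ext_sim[OF N(1)] N(2)] ext_rel[OF N(1) K(2)] by blast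
  then show ?case
    using N ext_trans[OF K(1) N(1)] by auto
next
  case (Fun t)
  let ?e = "\<lambda>v. eval_tm (induced_map f) v t"
  obtain K K' where K: "ext (Suc k) L L' K K'" "rel K K' (?e v) (?e v')"
    using Fun.IH[of "Suc k" L L'] Fun.prems by auto
  obtain N N' c' where N: "ext k K K' N N'" "rel N N' (induced_map f (?e v)) c'"
    using ext_forth[OF ext_sim[OF K(1)]] by blast
  have "c' = induced_map f (?e v')"
    using rel_ops(7)[OF ext_sim[OF N(1)] N(2)] ext_rel[OF N(1) K(2)] by blast
  then show ?case
    using N ext_trans[OF K(1) N(1)] by auto
next
  case (Meet s t)
  let ?e = "\<lambda>v t. eval_tm (induced_map f) v t"
  obtain J J' where J: "ext (Suc k + rank_tm t) L L' J J'" "rel J J' (?e v s) (?e v' s)"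
    using Meet.IH(1)[of "Suc k + rank_tm t" L L'] Meet.prems by (auto simp: ac_simps)
  obtain K K' where K: "ext (Suc k) J J' K K'" "rel K K' (?e v t) (?e v' t)"
    using Meet.IH(2)[OF ext_sim[OF J(1)]] Meet.prems ext_rel[OF J(1)] by auto
  obtain N N' c' where N: "ext k K K' N N'" "rel N N' (inf (?e v s) (?e v t)) c'"
    using ext_forth[OF ext_sim[OF K(1)]] by blast
  have "c' = inf (?e v' s) (?e v' t)"
    using rel_ops(5)[OF ext_sim[OF N(1)] N(2)] ext_rel[OF N(1)] ext_rel[OF K(1) J(2)] K(2) by blast
  then show ?case
    using N ext_trans[OF J(1) ext_trans[OF K(1) N(1)]] by auto
next
  case (Join s t)
  let ?e = "\<lambda>v t. eval_tm (induced_map f) v t"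
  obtain J J' where J: "ext (Suc k + rank_tm t) L L' J J'" "rel J J' (?e v s) (?e v' s)"
    using Join.IH(1)[of "Suc k + rank_tm t" L L'] Join.prems by (auto simp: ac_simps)
  obtain K K' where K: "ext (Suc k) J J' K K'" "rel K K' (?e v t) (?e v' t)"
    using Join.IH(2)[OF ext_sim[OF J(1)]] Join.prems ext_rel[OF J(1)] by auto
  obtain N N' c' where N: "ext k K K' N N'" "rel N N' (sup (?e v s) (?e v t)) c'"
    using ext_forth[OF ext_sim[OF K(1)]] by blast
  have "c' = sup (?e v' s) (?e v' t)"
    using rel_ops(6)[OF ext_sim[OF N(1)] N(2)] ext_rel[OF N(1)] ext_rel[OF K(1) J(2)] K(2) by blast
  then show ?case
    using N ext_trans[OF J(1) ext_trans[OF K(1) N(1)]] by auto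
qed

text \<open>The Ehrenfeucht-Fraisse argument: a quantifier costs one round, an equation as many
  rounds as its two terms need.\<close>

lemma sat_sim:
  fixes v v' :: "nat \<Rightarrow> pnfin"
  assumes "sim (rank \<phi>) L L'"
    and "\<And>i. i \<in> free_vars \<phi> \<Longrightarrow> rel L L' (v i) (v' i)"
    and "\<And>a. a \<in> params \<phi> \<Longrightarrow> rel L L' a a"
  shows "sat (induced_map f) v \<phi> \<longleftrightarrow> sat (induced_map f) v' \<phi>"
  using assms
proof (induction \<phi> arbitrary: L L' v v')
  case (Equal s t)
  let ?e = "\<lambda>v t. eval_tm (induced_map f) v t"
  obtain J J' where J: "ext (rank_tm t) L L' J J'" "rel J J' (?e v s) (?e v' s)"
    using eval_sim[of "rank_tm t" s L L' v v'] Equal.prems by (auto simp: ac_simps)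
  obtain K K' where K: "ext 0 J J' K K'" "rel K K' (?e v t) (?e v' t)"
    using eval_sim[of 0 t J J' v v'] ext_sim[OF J(1)] Equal.prems ext_rel[OF J(1)] by auto
  show ?case
    using rel_ops(3)[OF ext_sim[OF K(1)] ext_rel[OF K(1) J(2)] K(2) K(2)] by simp
next
  case (Neg \<phi>)
  have "sat (induced_map f) v \<phi> \<longleftrightarrow> sat (induced_map f) v' \<phi>"
    by (rule Neg.IH) (use Neg.prems in auto)
  then show ?case by simp
next
  case (Conj \<phi> \<psi>)
  have "sat (induced_map f) v \<phi> \<longleftrightarrow> sat (induced_map f) v' \<phi>"
    by (rule Conj.IH(1)) (use Conj.prems sim_mono[OF Conj.prems(1)] in auto)
  moreover have "sat (induced_map f) v \<psi> \<longleftrightarrow> sat (induced_map f) v' \<psi>"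
    by (rule Conj.IH(2)) (use Conj.prems sim_mono[OF Conj.prems(1)] in auto)
  ultimately show ?case by simp
next
  case (Exists i \<phi>)
  \<comment> \<open>Lists and valuations are arbitrary here, so that the statement serves both
    directions with the sides exchanged.\<close>
  have *: "\<exists>c'. sat (induced_map f) (u(i := b)) \<phi> \<longleftrightarrow> sat (induced_map f) (u'(i := c')) \<phi>"
    if sim: "sim (Suc (rank \<phi>)) L L'"
      and u: "\<And>j. j \<in> free_vars \<phi> - {i} \<Longrightarrow> rel L L' (u j) (u' j)"
      and a: "\<And>a. a \<in> params \<phi> \<Longrightarrow> rel L L' a a"
    for L L' b u u'
  proof -
    obtain K K' c' where K: "ext (rank \<phi>) L L' K K'" "rel K K' b c'"
      using ext_forth[OF sim] by blast
    have "sat (induced_map f) (u(i := b)) \<phi> \<longleftrightarrow> sat (induced_map f) (u'(i := c')) \<phi>"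
      by (rule Exists.IH[OF ext_sim[OF K(1)]]) (use K(2) ext_rel[OF K(1)] u a in auto)
    then show ?thesis ..
  qed
  have sim: "sim (Suc (rank \<phi>)) L L'" "sim (Suc (rank \<phi>)) L' L"
    using Exists.prems(1) sim_sym by simp_all
  have rel: "rel L L' (v j) (v' j)" "rel L' L (v' j) (v j)" if "j \<in> free_vars \<phi> - {i}" for j
    using Exists.prems(2)[of j] that rel_sym[OF _ sim_length[OF sim(1)]] by auto
  have par: "rel L L' a a" "rel L' L a a" if "a \<in> params \<phi>" for a
    using Exists.prems(3)[of a] that rel_sym[OF _ sim_length[OF sim(1)]] by auto
  show ?case
  proof
    assume "sat (induced_map f) v (Exists i \<phi>)"
    then obtain c where "sat (induced_map f) (v(i := c)) \<phi>" by auto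
    then show "sat (induced_map f) v' (Exists i \<phi>)"
      using *[where u = v and u' = v' and b = c, OF sim(1) rel(1) par(1)] by auto
  next
    assume "sat (induced_map f) v' (Exists i \<phi>)"
    then obtain c where "sat (induced_map f) (v'(i := c)) \<phi>" by auto
    then show "sat (induced_map f) v (Exists i \<phi>)"
      using *[where u = v' and u' = v and b = c, OF sim(2) rel(2) par(2)] by auto
  qed
qed

section \<open>Saturation\<close>

lemma ty_forth_list:
  assumes "ty (k + n) i j L = ty (k + n) i' j' L'" "length M = n"
  shows "\<exists>M'. length M' = n \<and> ty k i j (L @ M) = ty k i' j' (L' @ M')"
  using assms
proof (induction n arbitrary: L L' M)
  case 0
  then show ?case by simp
next
  case (Suc n)
  then obtain X N where M: "M = X # N" "length N = n"
    by (cases M) auto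
  obtain X' where "ty (k + n) i j (L @ [X]) = ty (k + n) i' j' (L' @ [X'])"
    using ty_forth[of "k + n" i j L i' j' L' X] Suc.prems(1) by auto
  from Suc.IH[OF this M(2)] obtain N'
    where "length N' = n" "ty k i j ((L @ [X]) @ N) = ty k i' j' ((L' @ [X']) @ N')"
    by blast
  then show ?case
    by (intro exI[of _ "X' # N'"]) (simp add: M)
qed

text \<open>The values of \<open>d\<close> are cuts between which the parameters \<open>P\<close> look alike at every rank.
  Since \<open>ty (k + n)\<close> of the parameters determines which \<open>ty k\<close> are attainable by adding \<open>n\<close>
  sets, a piece of any approximate realization \<open>W j\<close> can be copied between any two of these
  cuts, which makes it possible to diagonalize over \<open>j\<close>.\<close>

lemma merge_realizations:
  fixes P :: "nat \<Rightarrow> nat set" and W :: "nat \<Rightarrow> nat set list"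
  assumes len_W: "\<And>j. length (W j) = n"
  shows "\<exists>X. length X = n \<and>
    (\<forall>k. \<exists>j\<ge>k. sim k (map P [0..<k] @ W j) (map P [0..<k] @ X))"
proof -
  define Ps where "Ps k = map P [0..<k]" for k
  have len_Ps [simp]: "length (Ps k) = k" for k
    by (simp add: Ps_def)
  note len_W [simp]
  have "finite {ty (k + n) s t (Ps k) | s t. True}" for k
    by (rule finite_subset[OF _ finite_ty[of "k + n" k]]) (use len_Ps in blast)
  \<comment> \<open>First Ramsey step: between cuts \<open>d s\<close> with \<open>s \<ge> k\<close>
    the first \<open>k\<close> parameters have a constant type. The rank \<open>k + n\<close>
    reserves \<open>n\<close> moves for the sets to be found.\<close>
  from Ramsey_fusion[of "\<lambda>k s t. ty (k + n) s t (Ps k)", OF this] obtain d u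
    where d: "strict_mono d"
      and u: "\<And>k s t. k \<le> s \<Longrightarrow> s < t \<Longrightarrow> ty (k + n) (d s) (d t) (Ps k) = u k"
    by auto
  have len_PW: "length (Ps k @ W j) = k + n" for k j
    by simp
  \<comment> \<open>Second Ramsey step, separately for each \<open>j\<close>: a subsequence of the
    cuts along which \<open>W j\<close> is homogeneous too, with types \<open>e j k\<close>.\<close>
  have "\<exists>g e. strict_mono g \<and> (\<forall>k s t. k \<le> s \<and> s < t \<longrightarrow> ty k (d (g s)) (d (g t)) (Ps k @ W j) = e k)" for j
  proof (rule Ramsey_fusion)
    show "finite {ty k (d s) (d t) (Ps k @ W j) | s t. True}" for k
      by (rule finite_subset[OF _ finite_ty[of k "k + n"]]) (use len_PW in blast)
  qed
  then obtain g e where g: "\<And>j. strict_mono (g j)"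
    and e: "\<And>j k s t. k \<le> s \<Longrightarrow> s < t \<Longrightarrow> ty k (d (g j s)) (d (g j t)) (Ps k @ W j) = e j k"
    by metis
  have e_ty: "e j k = ty k (d (g j k)) (d (g j (Suc k))) (Ps k @ W j)" for j k
    by (rule e[symmetric]) auto
  have "finite {e s k | s t :: nat. True}" for k
    by (rule finite_subset[OF _ finite_ty[of k "k + n"]]) (use len_PW e_ty in blast)
  \<comment> \<open>Third step: the colour ignores \<open>t\<close>, so this is a diagonal
    pigeonhole choice of indices \<open>h j\<close> for which \<open>e (h j) k\<close> no longer
    depends on \<open>j \<ge> k\<close>.\<close>
  from Ramsey_fusion[of "\<lambda>k s t. e s k", OF this] obtain h w
    where h: "strict_mono h" and hw: "\<forall>k s t. k \<le> s \<and> s < t \<longrightarrow> e (h s) k = w k"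
    by (elim exE conjE)
  have w: "e (h j) k = w k" if "k \<le> j" for j k
    using hw[rule_format, OF conjI, OF that lessI] .
  have "\<exists>Z. length Z = n \<and> (\<forall>k\<le>j. ty k (d j) (d (Suc j)) (Ps k @ Z) = w k)" for j
  proof -
    let ?c = "d (g (h j) j)" and ?c' = "d (g (h j) (Suc j))"
    have "g (h j) j < g (h j) (Suc j)" "j \<le> g (h j) j"
      using g strict_mono_imp_increasing by (auto simp: strict_mono_less)
    \<comment> \<open>Both pieces lie between cuts of index at least \<open>j\<close>, so the
      parameters look alike in them and the piece of \<open>W (h j)\<close> can be copied.\<close>
    then have "ty (j + n) ?c ?c' (Ps j) = ty (j + n) (d j) (d (Suc j)) (Ps j)"
      using u[of j j "Suc j"] u[of j "g (h j) j" "g (h j) (Suc j)"] by simp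
    from ty_forth_list[OF this len_W] obtain Z
      where Z: "length Z = n" "ty j ?c ?c' (Ps j @ W (h j)) = ty j (d j) (d (Suc j)) (Ps j @ Z)"
      by blast
    have "ty k (d j) (d (Suc j)) (Ps k @ Z) = w k" if "k \<le> j" for k
    proof -
      \<comment> \<open>This keeps the first \<open>k\<close> parameters and the \<open>n\<close>
        added sets and drops the parameters in between.\<close>
      let ?idx = "[0..<k] @ [j..<j + n]"
      have idx: "map ((!) (Ps j @ M)) ?idx = Ps k @ M" if "length M = n" for M
        using that \<open>k \<le> j\<close> by (intro nth_equalityI) (auto simp: nth_append Ps_def)
      have "ty j ?c ?c' (map ((!) (Ps j @ W (h j))) ?idx)
          = ty j (d j) (d (Suc j)) (map ((!) (Ps j @ Z)) ?idx)"
        by (rule ty_reindex[OF Z(2)]) (use Z(1) \<open>k \<le> j\<close> in auto)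
      then have "ty j ?c ?c' (Ps k @ W (h j)) = ty j (d j) (d (Suc j)) (Ps k @ Z)"
        unfolding idx[OF len_W] idx[OF Z(1)] .
      then have "ty k ?c ?c' (Ps k @ W (h j)) = ty k (d j) (d (Suc j)) (Ps k @ Z)"
        by (rule ty_mono) (use Z(1) \<open>k \<le> j\<close> in auto)
      then show ?thesis
        using e[OF \<open>k \<le> j\<close> lessI, of "h j"] w[OF \<open>k \<le> j\<close>] by simp
    qed
    with Z(1) show ?thesis by blast
  qed
  then obtain Z where len_Z: "\<And>j. length (Z j) = n"
    and Z: "\<And>j k. k \<le> j \<Longrightarrow> ty k (d j) (d (Suc j)) (Ps k @ Z j) = w k"
    by metis
  define X where "X = map (\<lambda>i. {m. \<exists>j. d j \<le> blk m \<and> blk m < d (Suc j) \<and> m \<in> Z j ! i}) [0..<n]"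
  have X_iff: "m \<in> X ! i \<longleftrightarrow> m \<in> Z j ! i" if m: "d j \<le> blk m" "blk m < d (Suc j)" "i < n" for m i j
  proof -
    have *: "j' = j" if "d j' \<le> blk m" "blk m < d (Suc j')" for j'
    proof -
      have "d j < d (Suc j')" "d j' < d (Suc j)"
        using that m by linarith+
      then show ?thesis using d by (simp add: strict_mono_less)
    qed
    have "m \<in> X ! i \<longleftrightarrow> (\<exists>j. d j \<le> blk m \<and> blk m < d (Suc j) \<and> m \<in> Z j ! i)"
      using m(3) by (simp add: X_def)
    also have "\<dots> \<longleftrightarrow> m \<in> Z j ! i"
      using * m(1,2) by metis
    finally show ?thesis .
  qed
  have X: "ty k (d j) (d (Suc j)) (Ps k @ X) = w k" if "k \<le> j" for k j
  proof -
    have "label X m = label (Z j) m" if "d j \<le> blk m" "blk m < d (Suc j)" for m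
      using X_iff[OF that] len_Z by (intro nth_equalityI) (auto simp: X_def)
    then have "ty k (d j) (d (Suc j)) (Ps k @ X) = ty k (d j) (d (Suc j)) (Ps k @ Z j)"
      using d len_Z by (intro ty_cong) (auto simp: strict_mono_less X_def)
    then show ?thesis using Z[OF that] by simp
  qed
  have "sim k (Ps k @ W (h k)) (Ps k @ X)" for k
    unfolding sim_def
  proof (intro conjI exI allI)
    \<comment> \<open>Both cut sequences start at index \<open>k\<close>, from which on the types of
      rank \<open>k\<close> are constantly \<open>w k\<close>.\<close>
    show "strict_mono (\<lambda>s. d (g (h k) (k + s)))" "strict_mono (\<lambda>s. d (k + s))"
      using d g by (auto simp: strict_mono_def)
    show "ty k (d (g (h k) (k + s))) (d (g (h k) (k + Suc s))) (Ps k @ W (h k))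
        = ty k (d (k + s)) (d (k + Suc s)) (Ps k @ X)" for s
      using e[of k "k + s" "k + Suc s" "h k"] w[of k k] X[of k "k + s"] by simp
  qed (simp add: X_def)
  moreover have "k \<le> h k" for k
    by (rule strict_mono_imp_increasing[OF h])
  moreover have "length X = n" by (simp add: X_def)
  ultimately show ?thesis unfolding Ps_def by blast
qed

text \<open>Solutions \<open>v j\<close> of growing finite parts of the type are merged into one
  list \<open>X\<close>. Each formula involves finitely many parameters and has finite rank, so
  \<open>X\<close> inherits it from a late \<open>v j\<close>.\<close>

lemma saturated: "countably_saturated (induced_map f)"
  unfolding countably_saturated_def
proof (intro allI impI, elim conjE)
  fix n and A :: "pnfin set" and p
  assume A: "countable A" and p: "type_over n A p" and cons: "consistent_type (induced_map f) p"
  show "realized (induced_map f) p"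
  \<comment> \<open>Enumerating \<open>p\<close> as the range of a sequence requires it to be
    nonempty.\<close>
  proof (cases "p = {}")
    case True
    then show ?thesis by (simp add: realized_def)
  next
    case False
    have "countable p"
      by (rule countable_subset[OF _ countable_formulas[OF A]]) (use p in \<open>auto simp: type_over_def\<close>)
    define \<phi> where "\<phi> = from_nat_into p"
    have \<phi>: "range \<phi> = p"
      unfolding \<phi>_def by (rule range_from_nat_into[OF False \<open>countable p\<close>])
    define a where "a = from_nat_into A"
    have a: "A \<subseteq> range a"
      unfolding a_def by (rule subset_range_from_nat_into[OF A])
    define r where "r = rep_pnfin"
    have r: "abs_pnfin (r c) = c" for c
      using Quotient_abs_rep[OF Quotient_pnfin] by (simp add: r_def)
    have "\<exists>v. \<forall>i\<le>j. sat (induced_map f) v (\<phi> i)" for j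
      using cons[unfolded consistent_type_def, rule_format, of "\<phi> ` {..j}"] \<phi>
      by (auto simp: realized_def)
    then have "\<forall>j. \<exists>v. \<forall>i\<le>j. sat (induced_map f) v (\<phi> i)" ..
    from choice[OF this] obtain v where v: "\<And>i j. i \<le> j \<Longrightarrow> sat (induced_map f) (v j) (\<phi> i)"
      by blast
    define P where "P i = r (a i)" for i
    define W where "W j = map (\<lambda>i. r (v j i)) [0..<n]" for j
    obtain X where X: "length X = n"
      "\<And>k. \<exists>j\<ge>k. sim k (map P [0..<k] @ W j) (map P [0..<k] @ X)"
      using merge_realizations[of W n P] by (auto simp: W_def)
    have "sat (induced_map f) (\<lambda>i. abs_pnfin (X ! i)) (\<phi> i)" for i
    proof -
      have \<phi>i: "free_vars (\<phi> i) \<subseteq> {..<n}" "params (\<phi> i) \<subseteq> A"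
        using p \<phi> unfolding type_over_def by auto
      obtain C where C: "finite C" "params (\<phi> i) = a ` C"
        using finite_subset_image[OF finite_params order_trans[OF \<phi>i(2) a]] by blast
      obtain b where b: "\<forall>c\<in>C. c < b"
        using C(1) unfolding finite_nat_set_iff_bounded ..
      \<comment> \<open>Large enough for the rank, for all parameters of \<open>\<phi> i\<close> to
        be among the first \<open>k\<close>, and for \<open>v j\<close> with
        \<open>j \<ge> k\<close> to satisfy \<open>\<phi> i\<close>.\<close>
      define k where "k = i + b + rank (\<phi> i)"
      obtain j where j: "k \<le> j" "sim k (map P [0..<k] @ W j) (map P [0..<k] @ X)"
        using X(2) by blast
      have "sat (induced_map f) (v j) (\<phi> i) \<longleftrightarrow> sat (induced_map f) (\<lambda>i. abs_pnfin (X ! i)) (\<phi> i)"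
      proof (rule sat_sim)
        show "sim (rank (\<phi> i)) (map P [0..<k] @ W j) (map P [0..<k] @ X)"
          by (rule sim_mono[OF j(2)]) (simp add: k_def)
        show "rel (map P [0..<k] @ W j) (map P [0..<k] @ X) (v j x) (abs_pnfin (X ! x))"
          if "x \<in> free_vars (\<phi> i)" for x
          unfolding rel_def using that \<phi>i(1) X(1)
          by (intro exI[of _ "k + x"]) (auto simp: W_def nth_append r)
        show "rel (map P [0..<k] @ W j) (map P [0..<k] @ X) c c" if c: "c \<in> params (\<phi> i)" for c
        proof -
          obtain x where x: "x \<in> C" "c = a x" using c C(2) by auto
          then have "x < k" using b by (auto simp: k_def)
          with x show ?thesis
            unfolding rel_def by (intro exI[of _ x]) (auto simp: P_def nth_append r)
        qed
      qed
      moreover have "sat (induced_map f) (v j) (\<phi> i)"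
        by (rule v) (use j(1) in \<open>simp add: k_def\<close>)
      ultimately show ?thesis by simp
    qed
    then show ?thesis
      unfolding realized_def \<phi>[symmetric] by blast
  qed
qed

end

section \<open>Orbits\<close>

locale almost_perm =
  fixes f :: "nat \<rightharpoonup> nat"
  assumes perm: "almost_permutation f"
begin

text \<open>The flag selects the direction, so that statements about the two halves of an orbit have
  a single proof, with natural exponents.\<close>

definition arc :: "bool \<Rightarrow> (nat \<times> nat) set" where
  "arc s = (if s then {(n, m). f n = Some m} else {(n, m). f m = Some n})"

lemmas f_inj = almost_permutation_inj[OF perm]

lemma arc_True: "(n, m) \<in> arc True \<longleftrightarrow> f n = Some m"
  and arc_False: "(n, m) \<in> arc False \<longleftrightarrow> f m = Some n"
  by (simp_all add: arc_def)

lemma arc_Not: "arc (\<not> s) = (arc s)\<inverse>"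
  by (auto simp: arc_def)

lemma pow_Not: "(n, m) \<in> arc (\<not> s) ^^ j \<longleftrightarrow> (m, n) \<in> arc s ^^ j"
proof (induction j arbitrary: m)
  case (Suc j)
  have "(n, m) \<in> arc (\<not> s) ^^ Suc j \<longleftrightarrow> (\<exists>x. (x, n) \<in> arc s ^^ j \<and> (m, x) \<in> arc s)"
    using Suc.IH by (auto simp: arc_Not relcomp_unfold)
  also have "\<dots> \<longleftrightarrow> (m, n) \<in> arc s ^^ Suc j"
    by (metis relpow_Suc_D2 relpow_Suc_I2)
  finally show ?case .
qed auto

lemma pow_det: "(n, m) \<in> arc s ^^ j \<Longrightarrow> (n, m') \<in> arc s ^^ j \<Longrightarrow> m = m'"
proof (induction j arbitrary: m m')
  case (Suc j)
  then obtain x where "(x, m) \<in> arc s" "(x, m') \<in> arc s"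
    by (metis relpow_Suc_E)
  then show ?case by (cases s) (auto simp: arc_True arc_False dest: f_inj)
qed auto

lemma pow_inj: "(n, m) \<in> arc s ^^ j \<Longrightarrow> (n', m) \<in> arc s ^^ j \<Longrightarrow> n = n'"
  using pow_det[of m n j "\<not> s" n'] by (simp add: pow_Not)

lemma pow_add: "(n, m) \<in> arc s ^^ (i + j) \<longleftrightarrow> (\<exists>x. (n, x) \<in> arc s ^^ i \<and> (x, m) \<in> arc s ^^ j)"
  by (simp add: relpow_add relcomp_unfold)

lemma pow_add_left: "(n, x) \<in> arc s ^^ i \<Longrightarrow> (n, m) \<in> arc s ^^ (i + j) \<longleftrightarrow> (x, m) \<in> arc s ^^ j"
  unfolding pow_add using pow_det by metis

lemma pow_add_right: "(x, m) \<in> arc s ^^ j \<Longrightarrow> (n, m) \<in> arc s ^^ (i + j) \<longleftrightarrow> (n, x) \<in> arc s ^^ i"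
  unfolding pow_add using pow_inj by metis

lemma partial_inverse_eq: "partial_inverse f m = Some n \<longleftrightarrow> f n = Some m"
proof
  assume *: "partial_inverse f m = Some n"
  then have m: "m \<in> ran f" and n: "n = (THE n. f n = Some m)"
    by (auto simp: partial_inverse_def split: if_splits)
  then obtain n' where n': "f n' = Some m" by (auto simp: ran_def)
  then have "(THE n. f n = Some m) = n'" using f_inj by blast
  with n n' show "f n = Some m" by simp
next
  assume *: "f n = Some m"
  then have "(THE n. f n = Some m) = n" using f_inj by blast
  moreover have "m \<in> ran f" using * by (rule ranI)
  ultimately show "partial_inverse f m = Some n"
    by (simp add: partial_inverse_def)
qed

lemma funpow_eq_relpow:
  fixes h :: "'a \<rightharpoonup> 'a"
  shows "((\<lambda>g. h \<circ>\<^sub>m g) ^^ j) Some n = Some m \<longleftrightarrow> (n, m) \<in> {(n, m). h n = Some m} ^^ j"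
  by (induction j arbitrary: m) (auto simp: map_comp_Some_iff relcomp_unfold)

lemma iterate_eq:
  "iterate f k n = Some m \<longleftrightarrow> (n, m) \<in> arc (0 \<le> k) ^^ nat \<bar>k\<bar>"
proof (cases "0 \<le> k")
  case True
  then show ?thesis by (simp add: iterate_def funpow_eq_relpow arc_def)
next
  case False
  have "{(n, m). partial_inverse f n = Some m} = arc False"
    by (auto simp: partial_inverse_eq arc_False)
  with False show ?thesis by (simp add: iterate_def funpow_eq_relpow)
qed

lemma in_orbit_iff: "m \<in> orbit f n \<longleftrightarrow> (\<exists>s j. (n, m) \<in> arc s ^^ j)"
proof
  show "\<exists>s j. (n, m) \<in> arc s ^^ j" if "m \<in> orbit f n"
    using that unfolding orbit_def iterate_eq by blast
next
  assume "\<exists>s j. (n, m) \<in> arc s ^^ j"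
  then obtain s j where sj: "(n, m) \<in> arc s ^^ j" by blast
  show "m \<in> orbit f n"
  proof (cases "j = 0")
    case True
    with sj have "iterate f 0 n = Some m" by (simp add: iterate_def)
    then show ?thesis unfolding orbit_def by blast
  next
    case False
    define k where "k = (if s then int j else - int j)"
    have "(0 \<le> k) = s" "nat \<bar>k\<bar> = j"
      using False by (auto simp: k_def)
    with sj have "iterate f k n = Some m" by (simp add: iterate_eq)
    then show ?thesis unfolding orbit_def by blast
  qed
qed

lemma in_orbitI: "(n, m) \<in> arc s ^^ j \<Longrightarrow> m \<in> orbit f n"
  unfolding in_orbit_iff by blast

lemma orbit_refl: "n \<in> orbit f n"
  by (rule in_orbitI[of _ _ 0 True]) simp

lemma orbit_sym: "m \<in> orbit f n \<Longrightarrow> n \<in> orbit f m"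
  unfolding in_orbit_iff using pow_Not by metis

text \<open>Paths in the same direction concatenate; of two opposite ones the shorter cancels
  against the longer.\<close>

lemma orbit_trans:
  assumes "m \<in> orbit f n" "x \<in> orbit f m"
  shows "x \<in> orbit f n"
proof -
  obtain s i t j where *: "(n, m) \<in> arc s ^^ i" "(m, x) \<in> arc t ^^ j"
    using assms unfolding in_orbit_iff by blast
  consider "t = s" | "t = (\<not> s)" "j \<le> i" | "t = (\<not> s)" "i \<le> j"
    using linear[of i j] by (cases s; cases t) auto
  then show ?thesis
  proof cases
    case 1
    with * have "(n, x) \<in> arc s ^^ (i + j)"
      unfolding pow_add by blast
    then show ?thesis by (rule in_orbitI)
  next
    case 2
    with * have "(n, x) \<in> arc s ^^ (i - j)"
      using pow_add_right[of x m j s n "i - j"] by (simp add: pow_Not)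
    then show ?thesis by (rule in_orbitI)
  next
    case 3
    with * have "(x, n) \<in> arc s ^^ (j - i)"
      using pow_add_right[of n m i s x "j - i"] by (simp add: pow_Not)
    then show ?thesis using in_orbitI orbit_sym by blast
  qed
qed

lemma orbit_eq: "m \<in> orbit f n \<Longrightarrow> orbit f m = orbit f n"
  using orbit_trans orbit_sym by blast

lemma finite_pow: "finite {m. (n, m) \<in> arc s ^^ j}"
proof (rule finite_subset)
  show "{m. (n, m) \<in> arc s ^^ j} \<subseteq> {THE m. (n, m) \<in> arc s ^^ j}"
    using pow_det by (auto intro!: the_equality[symmetric])
qed simp

text \<open>On a cycle of length \<open>j > 0\<close>, all points of the orbit would be among the
  first \<open>j\<close> iterates.\<close>

lemma no_cycle:
  assumes inf: "infinite (orbit f n)" and cycle: "(n, n) \<in> arc s ^^ j"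
  shows "j = 0"
proof (rule ccontr)
  assume "j \<noteq> 0"
  have mult: "(n, n) \<in> arc s ^^ (j * q)" for q
  proof (induction q)
    case (Suc q)
    then show ?case using cycle by (auto simp: pow_add)
  qed simp
  have fwd: "m \<in> (\<Union>i<j. {m. (n, m) \<in> arc s ^^ i})" if "(n, m) \<in> arc s ^^ l" for m l
  proof -
    have "(n, m) \<in> arc s ^^ (j * (l div j) + l mod j)" using that by simp
    then have "(n, m) \<in> arc s ^^ (l mod j)"
      using pow_add_left[OF mult] by blast
    then show ?thesis using \<open>j \<noteq> 0\<close> by auto
  qed
  have "orbit f n \<subseteq> (\<Union>i<j. {m. (n, m) \<in> arc s ^^ i})"
  proof
    fix m assume "m \<in> orbit f n"
    then obtain t l where l: "(n, m) \<in> arc t ^^ l" unfolding in_orbit_iff by blast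
    show "m \<in> (\<Union>i<j. {m. (n, m) \<in> arc s ^^ i})"
    proof (cases "t = s")
      case True
      with l have "(n, m) \<in> arc s ^^ l" by simp
      then show ?thesis by (rule fwd)
    next
      case False
      then have "t = (\<not> s)" by auto
      with l have "(m, n) \<in> arc s ^^ l" by (simp add: pow_Not)
      \<comment> \<open>Going back \<open>l\<close> steps amounts to going forward
        \<open>j * l - l\<close> steps, as \<open>l\<close> rounds of the cycle have
        \<open>j * l\<close> steps.\<close>
      moreover have "(n, n) \<in> arc s ^^ ((j * l - l) + l)"
        using mult[of l] \<open>j \<noteq> 0\<close> by simp
      ultimately have "(n, m) \<in> arc s ^^ (j * l - l)"
        using pow_add_right by blast
      then show ?thesis by (rule fwd)
    qed
  qed
  then have "finite (orbit f n)"
    by (rule finite_subset) (simp add: finite_pow)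
  with inf show False by simp
qed

text \<open>Otherwise there is a cycle, of length the difference of the indices for equal directions
  and their sum for opposite ones. Only the base point itself is reached in both directions.\<close>

lemma unique_index:
  assumes inf: "infinite (orbit f b)" and n: "(b, n) \<in> arc s ^^ i" "(b, n) \<in> arc t ^^ j"
  shows "i = j \<and> (s = t \<or> i = 0)"
proof (cases "s = t")
  case True
  have *: "i = j" if "(b, n) \<in> arc s ^^ i" "(b, n) \<in> arc s ^^ j" "i \<le> j" for i j
  proof -
    have "(n, n) \<in> arc s ^^ (j - i)"
      using pow_add_left[OF that(1), of n "j - i"] that by simp
    moreover have "infinite (orbit f n)"
      using inf orbit_eq[OF in_orbitI[OF n(1)]] by simp
    ultimately have "j - i = 0" using no_cycle by blast
    with that(3) show ?thesis by simp
  qed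
  show ?thesis
    using *[of i j] *[of j i] n True by (cases "i \<le> j") auto
next
  case False
  then have "(n, b) \<in> arc s ^^ j"
    using n(2) pow_Not[of b n j s] by (cases s; cases t) auto
  with n(1) have "(b, b) \<in> arc s ^^ (i + j)" unfolding pow_add by blast
  then have "i + j = 0" by (rule no_cycle[OF inf])
  then show ?thesis by simp
qed

section \<open>Infinite orbits and the division into finite blocks\<close>

lemma Z_like_orbits_eq:
  "Z_like_orbits f = {orbit f n | n. infinite (orbit f n) \<and> (\<forall>s j. \<exists>m. (n, m) \<in> arc s ^^ j)}"
proof -
  have *: "(\<forall>k. iterate f k n \<noteq> None) \<longleftrightarrow> (\<forall>s j. \<exists>m. (n, m) \<in> arc s ^^ j)" for n
  proof
    assume all: "\<forall>k. iterate f k n \<noteq> None"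
    show "\<forall>s j. \<exists>m. (n, m) \<in> arc s ^^ j"
    proof (intro allI)
      fix s and j :: nat
      define k where "k = (if s then int j else - int j)"
      obtain m where "iterate f k n = Some m" using all by auto
      then have "(n, m) \<in> arc (0 \<le> k) ^^ nat \<bar>k\<bar>" by (simp only: iterate_eq)
      moreover have "nat \<bar>k\<bar> = j" "(0 \<le> k) = s \<or> j = 0"
        by (auto simp: k_def)
      ultimately show "\<exists>m. (n, m) \<in> arc s ^^ j" by (cases "j = 0") auto
    qed
  next
    assume all: "\<forall>s j. \<exists>m. (n, m) \<in> arc s ^^ j"
    show "\<forall>k. iterate f k n \<noteq> None"
      using all iterate_eq by (metis option.distinct(1))
  qed
  have "n \<in> dom f" if all: "\<forall>s j. \<exists>m. (n, m) \<in> arc s ^^ j" for n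
  proof -
    obtain m where "(n, m) \<in> arc True ^^ 1" using all by blast
    then show ?thesis by (simp add: arc_True domI)
  qed
  then show ?thesis
    unfolding Z_like_orbits_def * by blast
qed

text \<open>An infinite orbit that is not Z-like stops in some direction, hence meets the finite set
  of points outside \<open>dom f\<close> or \<open>ran f\<close>.\<close>

lemma finite_infinite_orbits:
  assumes "finite (Z_like_orbits f)"
  shows "finite {orbit f n | n. infinite (orbit f n)}"
proof (rule finite_subset)
  show "finite (Z_like_orbits f \<union> orbit f ` (- dom f \<union> - ran f))"
    using assms perm by (simp add: almost_permutation_def)
  show "{orbit f n | n. infinite (orbit f n)} \<subseteq> Z_like_orbits f \<union> orbit f ` (- dom f \<union> - ran f)"
  proof clarify
    fix n assume inf: "infinite (orbit f n)" and no: "orbit f n \<notin> orbit f ` (- dom f \<union> - ran f)"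
    have "\<exists>m. (n, m) \<in> arc s ^^ j" for s j
    proof (induction j)
      case 0
      then show ?case by auto
    next
      case (Suc j)
      then obtain m where m: "(n, m) \<in> arc s ^^ j" by blast
      then have "orbit f m = orbit f n" by (intro orbit_eq in_orbitI)
      with no have "m \<in> dom f" "m \<in> ran f" by blast+
      then obtain x where "(m, x) \<in> arc s"
        by (cases s) (auto simp: arc_True arc_False ran_def)
      with m show ?case by auto
    qed
    with inf show "orbit f n \<in> Z_like_orbits f"
      unfolding Z_like_orbits_eq by blast
  qed
qed

text \<open>Each finite orbit is put into one block. In an infinite orbit a base point is chosen,
  and the points at distance \<open>j\<close> along an endless half go to block \<open>j\<close>. A
  ray is a pair of direction and base, so its orientation is \<open>fst\<close>.\<close>

lemma ex_tape:
  assumes "finite (Z_like_orbits f)"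
  shows "\<exists>blk (R :: (bool \<times> nat) set) port fw. tape f blk R port fw"
proof -
  let ?O = "{orbit f n | n. infinite (orbit f n)}"
  define B where "B = (\<lambda>X. SOME b. b \<in> X) ` ?O"
  have rep: "(SOME b. b \<in> orbit f n) \<in> orbit f n" for n
    using orbit_refl by (rule someI)
  have finB: "finite B"
    unfolding B_def by (rule finite_imageI[OF finite_infinite_orbits[OF assms]])
  have B_eq: "b = (SOME b'. b' \<in> orbit f b) \<and> infinite (orbit f b)" if "b \<in> B" for b
  proof -
    obtain n where n: "b = (SOME b. b \<in> orbit f n)" "infinite (orbit f n)"
      using \<open>b \<in> B\<close> unfolding B_def by blast
    have "orbit f b = orbit f n"
      unfolding n(1) by (rule orbit_eq[OF rep])
    with n show ?thesis by simp
  qed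
  have B_unique: "b = b'" if "b \<in> B" "b' \<in> B" "n \<in> orbit f b" "n \<in> orbit f b'" for b b' n
    using that B_eq orbit_eq by metis
  have B_ex: "\<exists>b\<in>B. n \<in> orbit f b" if "infinite (orbit f n)" for n
    using that rep orbit_sym unfolding B_def by blast
  \<comment> \<open>Only the halves that never stop are rays. A Z-like orbit contributes two, which
    share their base at index 0.\<close>
  define R where "R = {(s, b). b \<in> B \<and> (\<forall>j. \<exists>n. (b, n) \<in> arc s ^^ j)}"
  define port where "port q j = (SOME n. (snd q, n) \<in> arc (fst q) ^^ j)" for q j
  define onray where "onray n j \<longleftrightarrow> (\<exists>s b. (s, b) \<in> R \<and> (b, n) \<in> arc s ^^ j)" for n j
  \<comment> \<open>Distinct finite orbits have distinct least elements, so each block receives at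
    most one of them. The value 0 at the end is for halves that stop, which have finitely many
    points in all.\<close>
  define blk where "blk n = (if finite (orbit f n) then LEAST m. m \<in> orbit f n
    else if \<exists>j. onray n j then THE j. onray n j else 0)" for n
  have port: "(b, port (s, b) j) \<in> arc s ^^ j" if "(s, b) \<in> R" for s b j
    using that someI_ex[of "\<lambda>n. (b, n) \<in> arc s ^^ j"] by (simp add: R_def port_def)
  have port_eq: "n = port (s, b) j" if "(s, b) \<in> R" "(b, n) \<in> arc s ^^ j" for n s b j
    using that port pow_det by blast
  have index: "i = j \<and> (s = t \<or> i = 0)"
    if "b \<in> B" "(t, b') \<in> R" "(b, n) \<in> arc s ^^ i" "(b', n) \<in> arc t ^^ j" for s b t b' n i j
  proof -
    have "b' = b"
      using B_unique[of b' b n] that in_orbitI by (auto simp: R_def)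
    with that B_eq unique_index show ?thesis by blast
  qed
  have onray_unique: "i = j" if "onray n i" "onray n j" for n i j
    using that index unfolding onray_def by (fastforce simp: R_def)
  have blk_onray: "blk n = j" if j: "onray n j" for n j
  proof -
    obtain s b where "(s, b) \<in> R" "(b, n) \<in> arc s ^^ j" using j unfolding onray_def by blast
    then have "infinite (orbit f n)"
      using B_eq orbit_eq[OF in_orbitI] by (auto simp: R_def)
    moreover have "(THE j. onray n j) = j" using j onray_unique by blast
    ultimately show ?thesis using j by (auto simp: blk_def)
  qed
  have blk_off: "blk n = 0" if "infinite (orbit f n)" "\<And>i. onray n i \<Longrightarrow> i = 0" for n
    using that(1) blk_onray that(2) by (cases "\<exists>j. onray n j") (auto simp: blk_def)
  have finR: "finite R"
    by (rule finite_subset[of _ "UNIV \<times> B"]) (use finB in \<open>auto simp: R_def\<close>)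
  \<comment> \<open>A step away from the base either follows a ray or stays, with both ends, in
    block 0.\<close>
  have edge: "blk n = blk m \<or> ((s, b) \<in> R \<and> n = port (s, b) j \<and> m = port (s, b) (Suc j))"
    if b: "b \<in> B" and n: "(b, n) \<in> arc s ^^ j" and m: "(n, m) \<in> arc s" for b n m s j
  proof (cases "(s, b) \<in> R")
    case True
    then show ?thesis using n m port_eq[of s b n j] port_eq[of s b m "Suc j"] by auto
  next
    case False
    have m': "(b, m) \<in> arc s ^^ Suc j" using n m by auto
    \<comment> \<open>On a half that stops, only the base can also lie on a ray, namely the opposite
      one, and its index there is 0.\<close>
    have off: "i = 0" if x: "onray x i" "(b, x) \<in> arc s ^^ l" for x i l
    proof -
      obtain t b' where t: "(t, b') \<in> R" "(b', x) \<in> arc t ^^ i"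
        using x unfolding onray_def by blast
      have "b' = b"
        using B_unique[of b' b x] t b x(2) in_orbitI by (auto simp: R_def)
      with False t have "s \<noteq> t" by (cases s; cases t) auto
      then show ?thesis using index[OF b t(1) x(2) t(2)] by auto
    qed
    have "infinite (orbit f n)" "infinite (orbit f m)"
      using B_eq[OF b] orbit_eq[OF in_orbitI[OF n]] orbit_eq[OF in_orbitI[OF m']] by auto
    then have "blk n = 0" "blk m = 0"
      using off[OF _ n] off[OF _ m'] by (auto intro!: blk_off)
    then show ?thesis by simp
  qed
  have "tape f blk R port fst"
  proof
    show "almost_permutation f" by (rule perm)
    show "finite R" by (rule finR)
    show "finite {n. blk n = i}" for i
    proof (rule finite_subset)
      \<comment> \<open>Block \<open>i\<close> is covered by the finite orbit through
        \<open>i\<close>, one point of each ray, and all halves that stop.\<close>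
      let ?F = "if finite (orbit f i) then orbit f i else {}"
      let ?R = "\<Union>q\<in>R. {n. (snd q, n) \<in> arc (fst q) ^^ i}"
      let ?S = "\<Union>(s, b)\<in>UNIV \<times> B - R. {n. \<exists>j. (b, n) \<in> arc s ^^ j}"
      show "{n. blk n = i} \<subseteq> ?F \<union> ?R \<union> ?S"
      proof
        fix n assume "n \<in> {n. blk n = i}"
        then have i: "blk n = i" by simp
        consider "finite (orbit f n)" | j where "onray n j" | "infinite (orbit f n)" "\<And>j. \<not> onray n j"
          by blast
        then show "n \<in> ?F \<union> ?R \<union> ?S"
        proof cases
          case 1
          then have "i = (LEAST m. m \<in> orbit f n)" using i by (simp add: blk_def)
          then have "i \<in> orbit f n" using orbit_refl LeastI by metis
          then have "orbit f i = orbit f n" by (rule orbit_eq)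
          with 1 show ?thesis using orbit_refl[of n] by simp
        next
          case 2
          then have "onray n i" using blk_onray i by blast
          then show ?thesis unfolding onray_def by force
        next
          case 3
          then obtain b where b: "b \<in> B" "n \<in> orbit f b" using B_ex by blast
          then obtain s j where "(b, n) \<in> arc s ^^ j" unfolding in_orbit_iff by blast
          with 3 b show ?thesis unfolding onray_def by blast
        qed
      qed
      have "finite {n. \<exists>j. (b, n) \<in> arc s ^^ j}" if sb: "(s, b) \<in> UNIV \<times> B - R" for s b
      proof -
        obtain J where J: "\<And>n. (b, n) \<notin> arc s ^^ J"
          using sb by (auto simp: R_def)
        have "j < J" if "(b, n) \<in> arc s ^^ j" for j n
        proof (rule ccontr)
          assume "\<not> j < J"
          then have "(b, n) \<in> arc s ^^ (J + (j - J))" using that by simp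
          with J show False unfolding pow_add by blast
        qed
        then have "{n. \<exists>j. (b, n) \<in> arc s ^^ j} \<subseteq> (\<Union>j<J. {n. (b, n) \<in> arc s ^^ j})" by blast
        then show ?thesis by (rule finite_subset) (simp add: finite_pow)
      qed
      then show "finite (?F \<union> ?R \<union> ?S)"
        using finR finB finite_pow by (auto intro!: finite_UN_I)
    qed
    show "blk (port q i) = i" if "q \<in> R" for q i
    proof (rule blk_onray)
      obtain s b where "q = (s, b)" by (rule prod.exhaust)
      then show "onray (port q i) i"
        using that port unfolding onray_def by blast
    qed
    show "if fst q then f (port q i) = Some (port q (Suc i)) else f (port q (Suc i)) = Some (port q i)"
      if "q \<in> R" for q i
    proof -
      obtain s b where q: "q = (s, b)" by (rule prod.exhaust)
      have "(b, port q i) \<in> arc s ^^ i" "(b, port q (Suc i)) \<in> arc s ^^ (i + 1)"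
        using port[of s b i] port[of s b "Suc i"] that q by auto
      then have "(port q i, port q (Suc i)) \<in> arc s"
        using pow_add_left[of b "port q i" i s "port q (Suc i)" 1] by simp
      then show ?thesis using q by (cases s) (auto simp: arc_True arc_False)
    qed
    show "blk n = blk m \<or> (\<exists>q\<in>R. \<exists>i. if fst q then n = port q i \<and> m = port q (Suc i)
       else n = port q (Suc i) \<and> m = port q i)" if f: "f n = Some m" for n m
    proof (cases "finite (orbit f n)")
      case True
      have "(n, m) \<in> arc True ^^ 1" using f by (simp add: arc_True)
      then have "orbit f m = orbit f n" by (intro orbit_eq in_orbitI)
      with True show ?thesis by (simp add: blk_def)
    next
      case False
      then obtain b s j where b: "b \<in> B" and n: "(b, n) \<in> arc s ^^ j"
        using B_ex unfolding in_orbit_iff by blast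
      \<comment> \<open>\<open>f\<close> leads away from the base on the forward half and towards it
        on the backward half; the base itself counts as forward.\<close>
      consider "(b, n) \<in> arc True ^^ j" | i where "(b, n) \<in> arc False ^^ Suc i"
      proof (cases s)
        case False
        then show ?thesis using n that by (cases j) auto
      qed (use n that in auto)
      then show ?thesis
      proof cases
        case 1
        have "blk n = blk m \<or> ((True, b) \<in> R \<and> n = port (True, b) j \<and> m = port (True, b) (Suc j))"
          by (rule edge[OF b 1]) (simp add: arc_True f)
        then show ?thesis by (metis fst_conv)
      next
        case 2
        then obtain x where x: "(b, x) \<in> arc False ^^ i" "(x, n) \<in> arc False" by auto
        then have "x = m" using f by (simp add: arc_False)
        have "blk m = blk n \<or> ((False, b) \<in> R \<and> m = port (False, b) i \<and> n = port (False, b) (Suc i))"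
          using edge[OF b x] \<open>x = m\<close> by simp
        then show ?thesis by (metis fst_conv)
      qed
    qed
  qed
  then show ?thesis by blast
qed

section \<open>Infinitely many Z-like orbits\<close>

lemma infinite_ray:
  assumes inf: "infinite (orbit f b)" and ex: "\<And>j. \<exists>n. (b, n) \<in> arc s ^^ j"
  shows "infinite {n. \<exists>j. (b, n) \<in> arc s ^^ Suc j}"
proof -
  have "\<forall>j. \<exists>n. (b, n) \<in> arc s ^^ Suc j" using ex by blast
  from choice[OF this] obtain g where g: "\<And>j. (b, g j) \<in> arc s ^^ Suc j" by blast
  have "inj g"
  proof (rule injI)
    fix i j assume "g i = g j"
    then have "Suc i = Suc j"
      using unique_index[OF inf g[of i]] g[of j] by metis
    then show "i = j" by simp
  qed
  then have "infinite (range g)" by (rule range_inj_infinite)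
  moreover have "range g \<subseteq> {n. \<exists>j. (b, n) \<in> arc s ^^ Suc j}"
    using g by blast
  ultimately show ?thesis by (rule infinite_super[rotated])
qed

text \<open>The type says that \<open>x\<close> is invariant, contains the positive halves of infinitely many
  Z-like orbits and is disjoint from their negative halves. An invariant element is,
  on all but finitely many orbits, either everything or nothing.\<close>

lemma not_saturated:
  assumes inf: "infinite (Z_like_orbits f)"
  shows "\<not> countably_saturated (induced_map f)"
proof
  assume sat: "countably_saturated (induced_map f)"
  obtain orb :: "nat \<Rightarrow> nat set" where "inj orb" and orb: "range orb \<subseteq> Z_like_orbits f"
    using infinite_countable_subset[OF inf] by blast
  have "\<forall>i. \<exists>n. orb i = orbit f n \<and> infinite (orbit f n) \<and> (\<forall>s j. \<exists>m. (n, m) \<in> arc s ^^ j)"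
    using orb unfolding Z_like_orbits_eq by blast
  from choice[OF this] obtain z where z: "\<And>i. orb i = orbit f (z i)" "\<And>i. infinite (orbit f (z i))"
    "\<And>i s j. \<exists>m. (z i, m) \<in> arc s ^^ j"
    by blast
  have disj: "i = i'" if "m \<in> orbit f (z i)" "m \<in> orbit f (z i')" for i i' m
  proof -
    have "orb i = orb i'" using orbit_eq that z(1) by metis
    with \<open>inj orb\<close> show ?thesis by (simp add: inj_eq)
  qed
  \<comment> \<open>The base \<open>z i\<close> belongs to the positive half; the exponent
    \<open>Suc j\<close> keeps it out of \<open>neg i\<close>.\<close>
  define pos where "pos i = {m. \<exists>j. (z i, m) \<in> arc True ^^ j}" for i
  define neg where "neg i = {m. \<exists>j. (z i, m) \<in> arc False ^^ Suc j}" for i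
  have pos_orbit: "pos i \<subseteq> orbit f (z i)" and neg_orbit: "neg i \<subseteq> orbit f (z i)" for i
    unfolding pos_def neg_def using in_orbitI by blast+
  have pos_neg: "pos i \<inter> neg i' = {}" for i i'
  proof (rule ccontr)
    assume "pos i \<inter> neg i' \<noteq> {}"
    then obtain m where m: "m \<in> pos i" "m \<in> neg i'" by blast
    then have "i' = i" using disj pos_orbit neg_orbit by blast
    with m obtain j l where "(z i, m) \<in> arc True ^^ j" "(z i, m) \<in> arc False ^^ Suc l"
      unfolding pos_def neg_def by blast
    from unique_index[OF z(2) this] show False by auto
  qed
  define inv :: "pnfin fm" where "inv = Equal (Fun (Var 0)) (Var 0)"
  define above where "above i = Equal (Meet (Param (abs_pnfin (pos i))) (Var 0)) (Param (abs_pnfin (pos i)))" for i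
  define below where "below i = Equal (Meet (Param (abs_pnfin (neg i))) (Var 0)) Zero" for i
  define p where "p = insert inv (range above \<union> range below)"
  define A where "A = range (\<lambda>i. abs_pnfin (pos i)) \<union> range (\<lambda>i. abs_pnfin (neg i))"
  have "countable A" by (simp add: A_def)
  moreover have "type_over 1 A p"
    by (auto simp: type_over_def p_def inv_def above_def below_def A_def)
  moreover have "consistent_type (induced_map f) p"
    unfolding consistent_type_def
  proof (intro allI impI, elim conjE)
    fix q :: "pnfin fm set" assume q: "finite q" "q \<subseteq> p"
    \<comment> \<open>The union of the first \<open>N\<close> positive halves realizes any finite
      part once \<open>N\<close> is large.\<close>
    define U where "U N = (\<Union>i<N. pos i)" for N :: nat
    define v where "v N = (\<lambda>_ :: nat. abs_pnfin (U N))" for N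
    have "sat (induced_map f) (v N) inv" for N
    proof -
      \<comment> \<open>Invariance can fail only at an edge entering one of the \<open>N\<close>
        base points.\<close>
      have "n \<in> U N \<longleftrightarrow> m \<in> U N" if nm: "f n = Some m" "m \<notin> z ` {..<N}" for n m
      proof -
        have "n \<in> pos i \<longleftrightarrow> m \<in> pos i" if "i < N" for i
        proof
          assume "n \<in> pos i"
          then obtain j where "(z i, n) \<in> arc True ^^ j" unfolding pos_def by blast
          moreover have "(n, m) \<in> arc True" using nm(1) by (simp add: arc_True)
          ultimately have "(z i, m) \<in> arc True ^^ Suc j" by (rule relpow_Suc_I)
          then show "m \<in> pos i" unfolding pos_def by blast
        next
          assume "m \<in> pos i"
          then obtain j where j: "(z i, m) \<in> arc True ^^ j" unfolding pos_def by blast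
          then obtain l where "j = Suc l" using nm(2) \<open>i < N\<close> by (cases j) auto
          with j obtain x where "(z i, x) \<in> arc True ^^ l" "(x, m) \<in> arc True" by auto
          moreover from this have "x = n" using f_inj nm(1) by (simp add: arc_True)
          ultimately show "n \<in> pos i" unfolding pos_def by blast
        qed
        then show ?thesis unfolding U_def by blast
      qed
      then have "{m. \<exists>n. f n = Some m \<and> (n \<in> U N) \<noteq> (m \<in> U N)} \<subseteq> z ` {..<N}" by blast
      then have "finite {m. \<exists>n. f n = Some m \<and> (n \<in> U N) \<noteq> (m \<in> U N)}"
        by (rule finite_subset) simp
      then have "abs_pnfin (U N) = induced_map f (abs_pnfin (U N))"
        unfolding induced_map_eq_iff[OF perm] .
      then show ?thesis by (simp add: inv_def v_def)
    qed
    moreover have "sat (induced_map f) (v N) (above i)" if "i < N" for i N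
    proof -
      have "pos i \<inter> U N = pos i" using that unfolding U_def by blast
      then show ?thesis by (simp add: above_def v_def inf_pnfin.abs_eq)
    qed
    moreover have "sat (induced_map f) (v N) (below i)" for i N
    proof -
      have "neg i \<inter> U N = {}" using pos_neg unfolding U_def by blast
      then show ?thesis by (simp add: below_def v_def inf_pnfin.abs_eq bot_pnfin.abs_eq)
    qed
    ultimately have "\<forall>\<phi>\<in>p. \<exists>N0. \<forall>N>N0. sat (induced_map f) (v N) \<phi>"
      unfolding p_def by blast
    then have "\<forall>\<phi>\<in>q. \<forall>\<^sub>F N in sequentially. sat (induced_map f) (v N) \<phi>"
      using q(2) unfolding eventually_at_top_dense by blast
    then have "\<forall>\<^sub>F N in sequentially. \<forall>\<phi>\<in>q. sat (induced_map f) (v N) \<phi>"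
      by (rule eventually_ball_finite[OF q(1)])
    then obtain N where "\<forall>\<phi>\<in>q. sat (induced_map f) (v N) \<phi>"
      unfolding eventually_sequentially by blast
    then show "realized (induced_map f) q" unfolding realized_def by blast
  qed
  ultimately have "realized (induced_map f) p"
    using sat unfolding countably_saturated_def by blast
  then obtain v where v: "\<And>\<phi>. \<phi> \<in> p \<Longrightarrow> sat (induced_map f) v \<phi>"
    unfolding realized_def by blast
  define X where "X = rep_pnfin (v 0)"
  have X: "v 0 = abs_pnfin X"
    using Quotient_abs_rep[OF Quotient_pnfin] by (simp add: X_def)
  define E where "E = {m. \<exists>n. f n = Some m \<and> (n \<in> X) \<noteq> (m \<in> X)}"
  have "finite E"
    using v[of inv] unfolding E_def induced_map_eq_iff[OF perm, symmetric] by (simp add: p_def inv_def X)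
  \<comment> \<open>Each point of \<open>E\<close> lies on at most one of the chosen orbits, so some
    orbit avoids \<open>E\<close> altogether, and \<open>X\<close> is constant on it.\<close>
  have "finite (\<Union>m\<in>E. {i. m \<in> orbit f (z i)})"
  proof (rule finite_UN_I[OF \<open>finite E\<close>])
    show "finite {i. m \<in> orbit f (z i)}" for m
    proof (cases "\<exists>i. m \<in> orbit f (z i)")
      case True
      then obtain i where "m \<in> orbit f (z i)" ..
      then have "{i. m \<in> orbit f (z i)} \<subseteq> {i}" using disj by blast
      then show ?thesis by (rule finite_subset) simp
    qed simp
  qed
  then obtain i where i: "\<And>m. m \<in> orbit f (z i) \<Longrightarrow> m \<notin> E"
    using ex_new_if_finite[OF infinite_UNIV_nat] by blast
  have const: "m \<in> X \<longleftrightarrow> z i \<in> X" if "(z i, m) \<in> arc s ^^ j" for m s j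
    using that
  proof (induction j arbitrary: m)
    case (Suc j)
    then obtain x where x: "(z i, x) \<in> arc s ^^ j" "(x, m) \<in> arc s" by auto
    have "m \<notin> E" "x \<notin> E" using i in_orbitI x(1) Suc.prems by blast+
    then have "m \<in> X \<longleftrightarrow> x \<in> X"
      using x(2) unfolding E_def by (cases s) (auto simp: arc_True arc_False)
    with Suc.IH[OF x(1)] show ?case by simp
  qed simp
  have inf_half: "infinite {n. \<exists>j. (z i, n) \<in> arc s ^^ Suc j}" for s
    by (rule infinite_ray) (use z in auto)
  show False
  proof (cases "z i \<in> X")
    case True
    then have "neg i \<inter> X = neg i" using const unfolding neg_def by blast
    then have "abs_pnfin (neg i) = bot"
      using v[of "below i"] by (simp add: p_def below_def X inf_pnfin.abs_eq)
    then have "finite (neg i)"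
      by (simp add: bot_pnfin.abs_eq pnfin.abs_eq_iff eq_mod_fin_def)
    then show False using inf_half[of False] by (simp add: neg_def)
  next
    case False
    then have "pos i \<inter> X = {}" using const unfolding pos_def by blast
    then have "abs_pnfin (pos i) = bot"
      using v[of "above i"] by (simp add: p_def above_def X inf_pnfin.abs_eq bot_pnfin.abs_eq)
    then have "finite (pos i)"
      by (simp add: bot_pnfin.abs_eq pnfin.abs_eq_iff eq_mod_fin_def)
    moreover have "{n. \<exists>j. (z i, n) \<in> arc True ^^ Suc j} \<subseteq> pos i"
      unfolding pos_def by blast
    ultimately show False using inf_half[of True] finite_subset by blast
  qed
qed

end

theorem theorem4p16:
  fixes f :: "nat \<rightharpoonup> nat"
  assumes "almost_permutation f"
  shows "countably_saturated (induced_map f) \<longleftrightarrow> finite (Z_like_orbits f)"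
proof -
  interpret almost_perm f by unfold_locales (rule assms)
  have "countably_saturated (induced_map f)" if "finite (Z_like_orbits f)"
    using ex_tape[OF that] tape.saturated by blast
  with not_saturated show ?thesis by blast
qed

end
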